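(* Let $\mathbf{y}^{(r)}_{\mathbf{a}_{\mathrm{s}}^1}=\bigl(y^{(r)}_{a_{\mathrm{s},1}^1},\dots,y^{(r)}_{a_{\mathrm{s},n_{\mathrm{e}}}^1}\bigr)$ be the optimal first-order moments associated with an optimal solution of the $r$-th relaxation of the scaled problem (S), and set $$\tilde{a}_e=\frac{y^{(r)}_{a_{\mathrm{s},e}^1}+1}{2}\,\frac{\overline{w}}{\rho_e\ell_e},\qquad e\in\{1,\dots,n_{\mathrm{e}}\}.$$ If $\inf_{\delta>0}c_j(\delta\tilde{\mathbf{a}})<\overline{c}_j$ holds for all $j\in\{1,\dots,n_{\mathrm{lc}}\}$ and the weight minimization problem (P) is solvable, then $\delta^*\tilde{\mathbf{a}}$, where $\delta^*$ is a solution of the univariate problem $(\mathrm{U}_{\tilde{\mathbf{a}}})$, is a feasible (upper-bound) solution to (P).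
   Context: Let $n_{\mathrm{e}}, n_{\mathrm{lc}}$ be positive integers and, for each $j\in\{1,\dots,n_{\mathrm{lc}}\}$, let $n_{\mathrm{dof},j}$ be a positive integer, $\mathbf{0}\neq\mathbf{f}_j\in\mathbb{R}^{n_{\mathrm{dof},j}}$ and $\overline{c}_j>0$. Let $\rho_e,\ell_e>0$ for $e\in\{1,\dots,n_{\mathrm{e}}\}$. For $\mathbf{a}\in\mathbb{R}^{n_{\mathrm{e}}}_{\ge 0}$ the stiffness matrix is $$\mathbf{K}_j(\mathbf{a})=\mathbf{K}_{j,0}+\sum_{e=1}^{n_{\mathrm{e}}}\sum_{i=1}^{3}\mathbf{K}^{(i)}_{j,e}a_e^i,$$ where $\mathbf{K}_{j,0}$ and $\mathbf{K}^{(i)}_{j,e}$ are fixed real symmetric positive semidefinite $n_{\mathrm{dof},j}\times n_{\mathrm{dof},j}$ matrices. Standing assumption: $\mathbf{K}_j(\mathbf{a})\succ 0$ for all $\mathbf{a}>\mathbf{0}$ (componentwise) and all $j$. The compliance is $c_j(\mathbf{a})=\mathbf{f}_j^{\mathrm{T}}\mathbf{K}_j(\mathbf{a})^{\dagger}\mathbf{f}_j$ ($\dagger$ is the Moore-Penrose pseudo-inverse), defined for $\mathbf{a}\ge\mathbf{0}$ with $\mathbf{f}_j\in\mathrm{Im}(\mathbf{K}_j(\mathbf{a}))$. Weight minimization problem: $$\text{(P)}\quad \min_{\mathbf{a},\mathbf{u}}\ \sum_{e=1}^{n_{\mathrm{e}}}\rho_e\ell_e a_e\quad\text{s.t.}\quad\mathbf{K}_j(\mathbf{a})\mathbf{u}_j=\mathbf{f}_j,\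 \ \overline{c}_j-\mathbf{f}_j^{\mathrm{T}}\mathbf{u}_j\ge 0\ \ \forall j,\quad \mathbf{a}\ge\mathbf{0}.$$ A vector $\mathbf{a}$ is called feasible for (P) if it is feasible together with some $\mathbf{u}_1,\dots,\mathbf{u}_{n_{\mathrm{lc}}}$; equivalently, $\mathbf{a}\ge\mathbf{0}$ and $\begin{pmatrix}\overline{c}_j&-\mathbf{f}_j^{\mathrm{T}}\\-\mathbf{f}_j&\mathbf{K}_j(\mathbf{a})\end{pmatrix}\succeq 0$ for all $j$. "Upper-bound" means that its weight $\sum_e\rho_e\ell_e a_e$ is an upper bound on the optimal value. Univariate problem: for $\hat{\mathbf{a}}\ge\mathbf{0}$ with $\mathbf{f}_j\in\mathrm{Im}(\mathbf{K}_j(\hat{\mathbf{a}}))$ for all $j$, $$(\mathrm{U}_{\hat{\mathbf{a}}})\quad\min_{\delta}\ \delta\quad\text{s.t.}\quad\mathbf{f}_j^{\mathrm{T}}\mathbf{K}_j(\delta\hat{\mathbf{a}})^{\dagger}\mathbf{f}_j\le\overline{c}_j\ \ \forall j,\quad\delta>0.$$ Scaled problem: fix any $\hat{\mathbf{a}}>\mathbf{0}$, let $\hat\delta$ be a solution of $(\mathrm{U}_{\hat{\mathbf{a}}})$ and put $\overline{w}=\hat\delta\sum_e\rho_e\ell_e\hat a_e$ (an upper bound on the optimal weight). Substituting $a_e=\frac{a_{\mathrm{s},e}+1}{2}\frac{\overline{w}}{\rho_e\ell_e}$ and writing $\mathbf{K}_j(\mathbf{a}_{\mathrm{s}})$ for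 the resulting polynomial matrix, define $$\text{(S)}\quad\min_{\mathbf{a}_{\mathrm{s}}}\ 0.5\,\overline{w}\,(n_{\mathrm{e}}+\mathbf{1}^{\mathrm{T}}\mathbf{a}_{\mathrm{s}})\quad\text{s.t.}\quad\begin{pmatrix}\overline{c}_j&-\mathbf{f}_j^{\mathrm{T}}\\-\mathbf{f}_j&\mathbf{K}_j(\mathbf{a}_{\mathrm{s}})\end{pmatrix}\succeq 0\ \ \forall j,\quad a_{\mathrm{s},e}^2\le 1\ \ \forall e.$$ Moment relaxations (Lasserre hierarchy): write all constraints of (S) as $\mathbf{G}(\mathbf{a}_{\mathrm{s}})\succeq 0$ with $\mathbf{G}$ block-diagonal (blocks: the matrix constraints and the scalars $1-a_{\mathrm{s},e}^2$), and let $d$ be the maximum degree of a polynomial in $\mathbf{G}$. Let $\mathbf{b}_k$ be the column vector of all monomials in $\mathbf{a}_{\mathrm{s}}$ of degree at most $k$. For a vector $\mathbf{y}$ of moments indexed by the monomials in $\mathbf{b}_{2r}$, with the moment of the monomial $1$ equal to $1$, let $L_{\mathbf{y}}$ be the linear map sending each monomial to its moment, applied entrywise to polynomial matrices. For $2r\ge d$ the $r$-th relaxation is $$f^{(r)}=\min_{\mathbf{y}}\ L_{\mathbf{y}}\bigl(0.5\,\overline{w}(n_{\mathrm{e}}+\mathbf{1}^{\mathrm{T}}\mathbf{a}_{\mathrm{s}})\bigr)\quad\text{s.t.}\quad\mathbf{M}_{2r}(\mathbf{y})=L_{\mathbf{y}}(\mathbf{b}_r\mathbf{b}_r^{\mathrm{T}})\succeq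 0,\quad\mathbf{M}_{2r-d}(\mathbf{G}\mathbf{y})=L_{\mathbf{y}}\bigl((\mathbf{b}_s\mathbf{b}_s^{\mathrm{T}})\otimes\mathbf{G}\bigr)\succeq 0,\quad s=\lfloor(2r-d)/2\rfloor.$$ The first-order moments are the entries $y_{a_{\mathrm{s},e}^1}$ of $\mathbf{y}$ corresponding to the degree-one monomials $a_{\mathrm{s},e}$. *)

theory Defs
  imports
    Complex_Main
    "HOL-Library.Poly_Mapping"
    "Jordan_Normal_Form.Matrix"
begin

section \<open>Matrices\<close>

definition psd :: "real mat \<Rightarrow> bool" where
  "psd A \<longleftrightarrow> square_mat A \<and> transpose_mat A = A \<and>
     (\<forall>v \<in> carrier_vec (dim_row A). 0 \<le> v \<bullet> (A *\<^sub>v v))"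

definition pd :: "real mat \<Rightarrow> bool" where
  "pd A \<longleftrightarrow> square_mat A \<and> transpose_mat A = A \<and>
     (\<forall>v \<in> carrier_vec (dim_row A). v \<noteq> 0\<^sub>v (dim_row A) \<longrightarrow> 0 < v \<bullet> (A *\<^sub>v v))"

definition mat_image :: "real mat \<Rightarrow> real vec set" where
  "mat_image A = (\<lambda>v. A *\<^sub>v v) ` carrier_vec (dim_col A)"

definition is_pinv :: "real mat \<Rightarrow> real mat \<Rightarrow> bool" where
  "is_pinv A X \<longleftrightarrow> X \<in> carrier_mat (dim_col A) (dim_row A) \<and>
     A * X * A = A \<and> X * A * X = X \<and>
     transpose_mat (A * X) = A * X \<and> transpose_mat (X * A) = X * A"

definition pinv :: "real mat \<Rightarrow> real mat" where
  "pinv A = (THE X. is_pinv A X)"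

definition kronecker :: "'a::times mat \<Rightarrow> 'a mat \<Rightarrow> 'a mat" where
  "kronecker A B = mat (dim_row A * dim_row B) (dim_col A * dim_col B)
     (\<lambda>(i, j). A $$ (i div dim_row B, j div dim_col B) * B $$ (i mod dim_row B, j mod dim_col B))"

text \<open>The bordered matrix with blocks \<open>c\<close>, \<open>-f\<^sup>T\<close>, \<open>-f\<close>, \<open>K\<close>.\<close>

definition bordered :: "'a::{zero,uminus} \<Rightarrow> 'a vec \<Rightarrow> 'a mat \<Rightarrow> 'a mat" where
  "bordered c f K = four_block_mat
     (mat 1 1 (\<lambda>_. c)) (mat 1 (dim_vec f) (\<lambda>(_, q). - (f $ q)))
     (mat (dim_vec f) 1 (\<lambda>(p, _). - (f $ p))) K"


section \<open>The weight minimization problem\<close>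

text \<open>
  Elements are indexed by \<open>e < num_el D\<close>, load cases by \<open>j < num_lc D\<close>; the fields are
  irrelevant outside these ranges. The matrix \<open>stiffc D j i e\<close> is the coefficient of the
  \<open>i\<close>-th power of \<open>a\<^sub>e\<close> in the stiffness matrix of load case \<open>j\<close>, for \<open>i \<in> {1..3}\<close>.
\<close>

record weight_data =
  num_el :: nat
  num_lc :: nat
  ndof   :: "nat \<Rightarrow> nat"
  force  :: "nat \<Rightarrow> real vec"
  cbound :: "nat \<Rightarrow> real"
  dens   :: "nat \<Rightarrow> real"
  len    :: "nat \<Rightarrow> real"
  stiff0 :: "nat \<Rightarrow> real mat"
  stiffc :: "nat \<Rightarrow> nat \<Rightarrow> nat \<Rightarrow> real mat"

definition stiffness :: "weight_data \<Rightarrow> nat \<Rightarrow> real vec \<Rightarrow> real mat" where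
  "stiffness D j a = mat (ndof D j) (ndof D j)
     (\<lambda>pq. stiff0 D j $$ pq + (\<Sum>e<num_el D. \<Sum>i=1..3. stiffc D j i e $$ pq * (a $ e) ^ i))"

definition nonneg_vec :: "nat \<Rightarrow> real vec \<Rightarrow> bool" where
  "nonneg_vec n a \<longleftrightarrow> a \<in> carrier_vec n \<and> (\<forall>e<n. 0 \<le> a $ e)"

definition pos_vec :: "nat \<Rightarrow> real vec \<Rightarrow> bool" where
  "pos_vec n a \<longleftrightarrow> a \<in> carrier_vec n \<and> (\<forall>e<n. 0 < a $ e)"

definition valid_data :: "weight_data \<Rightarrow> bool" where
  "valid_data D \<longleftrightarrow>
     num_el D > 0 \<and> num_lc D > 0 \<and>
     (\<forall>e<num_el D. dens D e > 0 \<and> len D e > 0) \<and>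
     (\<forall>j<num_lc D.
        ndof D j > 0 \<and> cbound D j > 0 \<and>
        force D j \<in> carrier_vec (ndof D j) \<and> force D j \<noteq> 0\<^sub>v (ndof D j) \<and>
        stiff0 D j \<in> carrier_mat (ndof D j) (ndof D j) \<and> psd (stiff0 D j) \<and>
        (\<forall>e<num_el D. \<forall>i\<in>{1..3}.
           stiffc D j i e \<in> carrier_mat (ndof D j) (ndof D j) \<and> psd (stiffc D j i e)) \<and>
        (\<forall>a. pos_vec (num_el D) a \<longrightarrow> pd (stiffness D j a)))"

definition weight :: "weight_data \<Rightarrow> real vec \<Rightarrow> real" where
  "weight D a = (\<Sum>e<num_el D. dens D e * len D e * a $ e)"

text \<open>The formula below is meaningful only on the domain described by \<open>compliance_domain\<close>.\<close>

definition compliance :: "weight_data \<Rightarrow> nat \<Rightarrow> real vec \<Rightarrow> real" where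
  "compliance D j a = force D j \<bullet> (pinv (stiffness D j a) *\<^sub>v force D j)"

definition compliance_domain :: "weight_data \<Rightarrow> real vec \<Rightarrow> bool" where
  "compliance_domain D a \<longleftrightarrow> nonneg_vec (num_el D) a \<and>
     (\<forall>j<num_lc D. force D j \<in> mat_image (stiffness D j a))"

definition P_feasible :: "weight_data \<Rightarrow> real vec \<Rightarrow> (nat \<Rightarrow> real vec) \<Rightarrow> bool" where
  "P_feasible D a u \<longleftrightarrow> nonneg_vec (num_el D) a \<and>
     (\<forall>j<num_lc D. u j \<in> carrier_vec (ndof D j) \<and>
        stiffness D j a *\<^sub>v u j = force D j \<and> 0 \<le> cbound D j - force D j \<bullet> u j)"

definition P_optimal :: "weight_data \<Rightarrow> real vec \<Rightarrow> (nat \<Rightarrow> real vec) \<Rightarrow> bool" where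
  "P_optimal D a u \<longleftrightarrow> P_feasible D a u \<and>
     (\<forall>a' u'. P_feasible D a' u' \<longrightarrow> weight D a \<le> weight D a')"

definition P_solvable :: "weight_data \<Rightarrow> bool" where
  "P_solvable D \<longleftrightarrow> (\<exists>a u. P_optimal D a u)"

definition P_value :: "weight_data \<Rightarrow> real" where
  "P_value D = Inf {weight D a | a u. P_feasible D a u}"


section \<open>The univariate problem\<close>

definition U_feasible :: "weight_data \<Rightarrow> real vec \<Rightarrow> real \<Rightarrow> bool" where
  "U_feasible D a \<delta> \<longleftrightarrow> \<delta> > 0 \<and> (\<forall>j<num_lc D. compliance D j (\<delta> \<cdot>\<^sub>v a) \<le> cbound D j)"

definition U_solution :: "weight_data \<Rightarrow> real vec \<Rightarrow> real \<Rightarrow> bool" where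
  "U_solution D a \<delta> \<longleftrightarrow> U_feasible D a \<delta> \<and> (\<forall>\<delta>'. U_feasible D a \<delta>' \<longrightarrow> \<delta> \<le> \<delta>')"


section \<open>Multivariate polynomials and moment relaxations\<close>

text \<open>
  A monomial is its finitely supported exponent function; multiplication of polynomials is
  the convolution product of \<open>poly_mapping\<close>.
\<close>

type_synonym monomial = "nat \<Rightarrow>\<^sub>0 nat"
type_synonym mpoly = "monomial \<Rightarrow>\<^sub>0 real"

definition pconst :: "real \<Rightarrow> mpoly" where
  "pconst c = Poly_Mapping.single 0 c"

definition mvar :: "nat \<Rightarrow> monomial" where
  "mvar e = Poly_Mapping.single e 1"

definition pvar :: "nat \<Rightarrow> mpoly" where
  "pvar e = Poly_Mapping.single (mvar e) 1"

definition mdeg :: "monomial \<Rightarrow> nat" where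
  "mdeg m = (\<Sum>e\<in>Poly_Mapping.keys m. Poly_Mapping.lookup m e)"

definition pdeg :: "mpoly \<Rightarrow> nat" where
  "pdeg p = Max (insert 0 (mdeg ` Poly_Mapping.keys p))"

definition pmat_degree :: "mpoly mat \<Rightarrow> nat" where
  "pmat_degree G = Max (insert 0 {pdeg (G $$ (p, q)) | p q. p < dim_row G \<and> q < dim_col G})"

definition monomials :: "nat \<Rightarrow> nat \<Rightarrow> monomial set" where
  "monomials n k = {m. Poly_Mapping.keys m \<subseteq> {..<n} \<and> mdeg m \<le> k}"

lemma finite_monomials: "finite (monomials n k)"
proof -
  have "Poly_Mapping.lookup m e \<le> k" if "m \<in> monomials n k" for m e
  proof (cases "e \<in> Poly_Mapping.keys m")
    case True
    then have "Poly_Mapping.lookup m e \<le> mdeg m"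
      unfolding mdeg_def by (intro member_le_sum) auto
    with that show ?thesis by (simp add: monomials_def)
  qed (simp add: in_keys_iff)
  moreover have "Poly_Mapping.lookup m e = 0" if "m \<in> monomials n k" "e \<notin> {..<n}" for m e
    using that unfolding monomials_def by (auto simp: in_keys_iff subset_iff)
  ultimately have "Poly_Mapping.lookup ` monomials n k
      \<subseteq> {f. \<forall>e. (e \<in> {..<n} \<longrightarrow> f e \<in> {..k}) \<and> (e \<notin> {..<n} \<longrightarrow> f e = 0)}"
    by auto
  then have "finite (Poly_Mapping.lookup ` monomials n k)"
    by (rule finite_subset) (intro finite_set_of_finite_funs; simp)
  then show ?thesis
    by (rule finite_imageD) (auto intro: inj_onI poly_mapping_eqI)
qed

text \<open>
  The vector \<open>b\<^sub>k\<close> lists the monomials in the linear order of \<open>poly_mapping\<close>; positive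
  semidefiniteness of the matrices built from it does not depend on this choice.
\<close>

definition mon_vec :: "nat \<Rightarrow> nat \<Rightarrow> mpoly vec" where
  "mon_vec n k = vec_of_list
     (map (\<lambda>m. Poly_Mapping.single m 1) (sorted_list_of_set (monomials n k)))"

definition mon_outer :: "nat \<Rightarrow> nat \<Rightarrow> mpoly mat" where
  "mon_outer n k = mat (dim_vec (mon_vec n k)) (dim_vec (mon_vec n k))
     (\<lambda>(p, q). mon_vec n k $ p * mon_vec n k $ q)"

text \<open>
  A moment sequence is given as a function on all monomials; the \<open>r\<close>-th relaxation reads only its
  values on \<open>monomials n (2 * r)\<close>.
\<close>

definition riesz :: "(monomial \<Rightarrow> real) \<Rightarrow> mpoly \<Rightarrow> real" where
  "riesz y p = (\<Sum>m\<in>Poly_Mapping.keys p. Poly_Mapping.lookup p m * y m)"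

definition moment_mat :: "nat \<Rightarrow> nat \<Rightarrow> (monomial \<Rightarrow> real) \<Rightarrow> real mat" where
  "moment_mat n k y = map_mat (riesz y) (mon_outer n (k div 2))"

definition localizing_mat ::
  "nat \<Rightarrow> nat \<Rightarrow> mpoly mat \<Rightarrow> (monomial \<Rightarrow> real) \<Rightarrow> real mat" where
  "localizing_mat n k G y = map_mat (riesz y) (kronecker (mon_outer n (k div 2)) G)"

text \<open>
  Relaxation of order \<open>r\<close> of minimizing \<open>p\<close> subject to \<open>G \<succeq> 0\<close> in \<open>n\<close> variables; to be used
  only when \<open>pmat_degree G \<le> 2 * r\<close>, as \<open>-\<close> is truncated subtraction.
\<close>

definition relax_feasible ::
  "nat \<Rightarrow> mpoly mat \<Rightarrow> nat \<Rightarrow> (monomial \<Rightarrow> real) \<Rightarrow> bool" where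
  "relax_feasible n G r y \<longleftrightarrow> y 0 = 1 \<and> psd (moment_mat n (2 * r) y) \<and>
     psd (localizing_mat n (2 * r - pmat_degree G) G y)"

definition relax_optimal ::
  "nat \<Rightarrow> mpoly \<Rightarrow> mpoly mat \<Rightarrow> nat \<Rightarrow> (monomial \<Rightarrow> real) \<Rightarrow> bool" where
  "relax_optimal n p G r y \<longleftrightarrow> relax_feasible n G r y \<and>
     (\<forall>y'. relax_feasible n G r y' \<longrightarrow> riesz y p \<le> riesz y' p)"


section \<open>The scaled problem\<close>

definition S_area :: "weight_data \<Rightarrow> real \<Rightarrow> nat \<Rightarrow> mpoly" where
  "S_area D w e = pconst (1 / 2) * (pvar e + 1) * pconst (w / (dens D e * len D e))"

definition S_stiffness :: "weight_data \<Rightarrow> real \<Rightarrow> nat \<Rightarrow> mpoly mat" where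
  "S_stiffness D w j = mat (ndof D j) (ndof D j)
     (\<lambda>pq. pconst (stiff0 D j $$ pq) +
        (\<Sum>e<num_el D. \<Sum>i=1..3. pconst (stiffc D j i e $$ pq) * S_area D w e ^ i))"

definition S_objective :: "weight_data \<Rightarrow> real \<Rightarrow> mpoly" where
  "S_objective D w = pconst (1 / 2 * w) * (of_nat (num_el D) + (\<Sum>e<num_el D. pvar e))"

definition S_constraint :: "weight_data \<Rightarrow> real \<Rightarrow> mpoly mat" where
  "S_constraint D w = diag_block_mat
     (map (\<lambda>j. bordered (pconst (cbound D j)) (map_vec pconst (force D j)) (S_stiffness D w j))
        [0..<num_lc D] @
      map (\<lambda>e. mat 1 1 (\<lambda>_. 1 - pvar e ^ 2)) [0..<num_el D])"

definition recovered :: "weight_data \<Rightarrow> real \<Rightarrow> (monomial \<Rightarrow> real) \<Rightarrow> real vec" where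
  "recovered D w y =
     vec (num_el D) (\<lambda>e. (y (mvar e) + 1) / 2 * (w / (dens D e * len D e)))"

end

theory Submission
  imports Defs "Jordan_Normal_Form.Determinant"
begin

text \<open>
  For \<open>K \<succeq> 0\<close>, the conditions \<open>f \<in> Im K\<close> and \<open>f\<^sup>T K\<^sup>\<dagger> f \<le> c\<close> together say that
  \<open>2 f\<^sup>T v - v\<^sup>T K v \<le> c\<close> for all \<open>v\<close>. This form is monotone in \<open>K\<close> and survives limits, so the
  feasible set of the univariate problem is an up-closed ray, relatively closed in \<open>\<delta> > 0\<close>.
  Its infimum is not \<open>0\<close>: otherwise the bound would hold with \<open>K\<^sub>j(0)\<close>, hence along every ray, and
  the univariate problem of the reference design would have no solution.

  The localizing constraint gives the same inequality with \<open>K\<close> replaced by the linearized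
  stiffness matrix \<open>L\<^sub>y(K\<^sub>j)\<close>. A vector in the kernel of \<open>K\<^sub>j\<close> at the recovered design lies in the
  kernel of every term with positive area. Where the recovered area is zero, the first moment is
  \<open>-1\<close>, and the moment constraints force the linearized square and cube of the area to
  vanish as well. The cube matters only if it occurs, and then the degree of the constraints
  makes the relaxation order at least two. Hence \<open>f\<^sub>j\<close> is orthogonal to that kernel.
\<close>

section \<open>Symmetric matrices and the pseudo-inverse\<close>

lemma real_scalar_prod_self_eq_0:
  fixes v :: "real vec"
  assumes "v \<in> carrier_vec n" "v \<bullet> v = 0"
  shows "v = 0\<^sub>v n"
proof -
  have "\<forall>i\<in>{0..<dim_vec v}. v $ i * v $ i = 0"
    using assms(2) unfolding scalar_prod_def
    by (subst (asm) sum_nonneg_eq_0_iff) auto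
  then show ?thesis using assms(1) by (intro eq_vecI) auto
qed

context
  fixes n :: nat and K :: "real mat"
  assumes K: "K \<in> carrier_mat n n" and sym: "transpose_mat K = K"
begin

section \<open>Kernel and image of the square of a symmetric matrix\<close>

lemma sym_scalar_prod_comm:
  assumes "u \<in> carrier_vec n" "v \<in> carrier_vec n"
  shows "u \<bullet> (K *\<^sub>v v) = (K *\<^sub>v u) \<bullet> v"
  using transpose_vec_mult_scalar[OF K assms(2,1)] sym by simp

text \<open>Symmetry turns \<open>v . K (K v)\<close> into the squared norm of \<open>K v\<close>.
  So K and its square have the same kernel, which is what lets factors of K be cancelled in
  \<open>sym_image_square\<close>.\<close>

lemma sym_square_kernel:
  assumes v: "v \<in> carrier_vec n" and "K *\<^sub>v (K *\<^sub>v v) = 0\<^sub>v n"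
  shows "K *\<^sub>v v = 0\<^sub>v n"
proof (rule real_scalar_prod_self_eq_0)
  show "K *\<^sub>v v \<in> carrier_vec n" using K v by simp
  then show "(K *\<^sub>v v) \<bullet> (K *\<^sub>v v) = 0"
    using sym_scalar_prod_comm[of v "K *\<^sub>v v"] assms by simp
qed

text \<open>This is p(K) v for the polynomial p with coefficient list \<open>cs\<close>, constant
  term first. In Horner form, removing the head of the list is division by the variable.\<close>

primrec horner :: "real vec \<Rightarrow> real list \<Rightarrow> real vec" where
  "horner v [] = 0\<^sub>v n"
| "horner v (c # cs) = c \<cdot>\<^sub>v v + K *\<^sub>v horner v cs"

lemma horner_carrier: "v \<in> carrier_vec n \<Longrightarrow> horner v cs \<in> carrier_vec n"
  using K by (induction cs) auto

lemma krylov_carrier: "v \<in> carrier_vec n \<Longrightarrow> ((*\<^sub>v) K ^^ i) v \<in> carrier_vec n"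
  using K by (induction i) auto

lemma horner_index:
  assumes v: "v \<in> carrier_vec n" and "p < n"
  shows "horner v cs $ p = (\<Sum>i<length cs. cs ! i * ((*\<^sub>v) K ^^ i) v $ p)"
  using assms(2)
proof (induction cs arbitrary: p)
  case (Cons c cs)
  have "(K *\<^sub>v horner v cs) $ p =
      (\<Sum>q<n. K $$ (p, q) * (\<Sum>i<length cs. cs ! i * ((*\<^sub>v) K ^^ i) v $ q))"
    using K Cons horner_carrier[OF v, of cs]
    by (auto simp: scalar_prod_def atLeast0LessThan intro!: sum.cong)
  also have "\<dots> = (\<Sum>i<length cs. cs ! i * (\<Sum>q<n. K $$ (p, q) * ((*\<^sub>v) K ^^ i) v $ q))"
    unfolding sum_distrib_left by (subst sum.swap) (simp add: mult_ac)
  also have "\<dots> = (\<Sum>i<length cs. cs ! i * ((*\<^sub>v) K ^^ Suc i) v $ p)"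
    using K Cons.prems krylov_carrier[OF v, THEN carrier_vecD]
    by (intro sum.cong) (auto simp: scalar_prod_def atLeast0LessThan)
  finally have "(K *\<^sub>v horner v cs) $ p =
      (\<Sum>i<length cs. cs ! i * ((*\<^sub>v) K ^^ Suc i) v $ p)" .
  moreover have "horner v (c # cs) $ p = c * v $ p + (K *\<^sub>v horner v cs) $ p"
    using v Cons.prems K by (simp del: index_mult_mat_vec)
  ultimately show ?case
    unfolding list.size add_Suc_right add_0_right sum.lessThan_Suc_shift by simp
qed simp

text \<open>The n + 1 Krylov vectors v, K v, ..., K^n v lie in dimension n, hence are linearly
  dependent; a nontrivial relation is a nonzero polynomial in K that annihilates v.\<close>

lemma krylov_dependent:
  assumes v: "v \<in> carrier_vec n"
  shows "\<exists>cs. horner v cs = 0\<^sub>v n \<and> (\<exists>c\<in>set cs. c \<noteq> 0)"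
proof -
  \<comment> \<open>The columns are the Krylov vectors, padded by a zero last row. The matrix
    becomes square and its transpose kills the last unit vector, so the determinant yields a kernel
    vector, which holds the coefficients of the relation.\<close>
  define A where "A = mat (Suc n) (Suc n) (\<lambda>(p, i). if p < n then ((*\<^sub>v) K ^^ i) v $ p else 0)"
  have A: "A \<in> carrier_mat (Suc n) (Suc n)" by (simp add: A_def)
  have "transpose_mat A *\<^sub>v unit_vec (Suc n) n = 0\<^sub>v (Suc n)"
    by (intro eq_vecI) (auto simp: A_def)
  then have "det (transpose_mat A) = 0"
    using A by (subst det_0_iff_vec_prod_zero[of _ "Suc n"]) (auto intro!: exI[of _ "unit_vec (Suc n) n"])
  then have "det A = 0" by (simp add: det_transpose[OF A])
  then obtain c where c: "c \<in> carrier_vec (Suc n)" "c \<noteq> 0\<^sub>v (Suc n)" "A *\<^sub>v c = 0\<^sub>v (Suc n)"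
    using det_0_iff_vec_prod_zero[OF A] by auto
  have "horner v (list_of_vec c) = 0\<^sub>v n"
  proof (intro eq_vecI)
    fix p assume "p < dim_vec (0\<^sub>v n :: real vec)"
    then have p: "p < n" by simp
    have "(A *\<^sub>v c) $ p = (\<Sum>i<Suc n. c $ i * ((*\<^sub>v) K ^^ i) v $ p)"
      using p c(1) by (simp add: A_def scalar_prod_def atLeast0LessThan mult.commute del: sum.lessThan_Suc)
    then show "horner v (list_of_vec c) $ p = 0\<^sub>v n $ p"
      using p c by (simp add: horner_index[OF v p] list_of_vec_index del: sum.lessThan_Suc)
  qed (use horner_carrier[OF v] in auto)
  moreover have "\<exists>x\<in>set (list_of_vec c). x \<noteq> 0"
  proof -
    obtain i where "i < Suc n" "c $ i \<noteq> 0"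
      using c(1,2) by (metis carrier_vecD eq_vecI index_zero_vec)
    then show ?thesis using c(1) by (auto simp: set_list_of_vec vec_set_def)
  qed
  ultimately show ?thesis by blast
qed

text \<open>Take a polynomial relation on v and cancel powers of K until its constant term c is
  nonzero: then \<open>c K v = - K (K h)\<close>, and dividing by c exhibits \<open>K v\<close> in
  the image of the square.\<close>

lemma sym_image_square:
  assumes v: "v \<in> carrier_vec n"
  shows "\<exists>u\<in>carrier_vec n. K *\<^sub>v v = K *\<^sub>v (K *\<^sub>v u)"
proof -
  \<comment> \<open>The induction keeps one factor K in front: dropping a zero constant term leaves
    two factors, of which \<open>sym_square_kernel\<close> removes only one.\<close>
  have "\<exists>u\<in>carrier_vec n. K *\<^sub>v v = K *\<^sub>v (K *\<^sub>v u)"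
    if "K *\<^sub>v horner v cs = 0\<^sub>v n" "\<exists>c\<in>set cs. c \<noteq> 0" for cs
    using that
  proof (induction cs)
    case (Cons c cs)
    let ?h = "horner v cs"
    have h: "?h \<in> carrier_vec n" by (rule horner_carrier[OF v])
    have Kh: "K *\<^sub>v ?h \<in> carrier_vec n" using K h by simp
    have eq: "c \<cdot>\<^sub>v (K *\<^sub>v v) + K *\<^sub>v (K *\<^sub>v ?h) = 0\<^sub>v n"
      using Cons.prems(1) K v Kh by (simp add: mult_add_distrib_mat_vec[OF K] mult_mat_vec[OF K])
    show ?case
    proof (cases "c = 0")
      case True
      have "0 \<cdot>\<^sub>v v + K *\<^sub>v ?h = K *\<^sub>v ?h"
        using v K by (intro eq_vecI) (auto simp del: index_mult_mat_vec)
      with True have "K *\<^sub>v (K *\<^sub>v ?h) = 0\<^sub>v n"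
        using Cons.prems(1) by simp
      then have "K *\<^sub>v ?h = 0\<^sub>v n" using sym_square_kernel[OF h] by simp
      then show ?thesis using Cons True by auto
    next
      case False
      have "K *\<^sub>v v = (- 1 / c) \<cdot>\<^sub>v (K *\<^sub>v (K *\<^sub>v ?h))"
      proof (intro eq_vecI)
        fix p assume "p < dim_vec ((- 1 / c) \<cdot>\<^sub>v (K *\<^sub>v (K *\<^sub>v ?h)))"
        then have p: "p < n" using K by simp
        then have "c * (K *\<^sub>v v) $ p + (K *\<^sub>v (K *\<^sub>v ?h)) $ p = 0"
          using arg_cong[OF eq, of "\<lambda>x. x $ p"] K by (simp del: index_mult_mat_vec)
        then show "(K *\<^sub>v v) $ p = ((- 1 / c) \<cdot>\<^sub>v (K *\<^sub>v (K *\<^sub>v ?h))) $ p"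
          using False p K by (simp add: field_simps del: index_mult_mat_vec)
      qed (use K in simp)
      also have "\<dots> = K *\<^sub>v (K *\<^sub>v ((- 1 / c) \<cdot>\<^sub>v ?h))"
        using h Kh by (simp add: mult_mat_vec[OF K])
      finally show ?thesis using h smult_carrier_vec by metis
    qed
  qed simp
  moreover obtain cs where "horner v cs = 0\<^sub>v n" "\<exists>c\<in>set cs. c \<noteq> 0"
    using krylov_dependent[OF v] by blast
  moreover have "K *\<^sub>v 0\<^sub>v n = 0\<^sub>v n" using K by (intro eq_vecI) auto
  ultimately show ?thesis by metis
qed

text \<open>The Fredholm alternative. With \<open>K f = K (K u)\<close>, the residual
  \<open>w = f - K u\<close> lies in the kernel, so it is orthogonal to f by hypothesis and to
  \<open>K u\<close> by symmetry; hence it is orthogonal to itself.\<close>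

lemma sym_mat_image_if_orthogonal_kernel:
  assumes f: "f \<in> carrier_vec n"
    and orth: "\<And>v. v \<in> carrier_vec n \<Longrightarrow> K *\<^sub>v v = 0\<^sub>v n \<Longrightarrow> f \<bullet> v = 0"
  shows "f \<in> mat_image K"
proof -
  obtain u where u: "u \<in> carrier_vec n" and eq: "K *\<^sub>v f = K *\<^sub>v (K *\<^sub>v u)"
    using sym_image_square[OF f] by blast
  define w where "w = f - K *\<^sub>v u"
  have Ku: "K *\<^sub>v u \<in> carrier_vec n" using K u by simp
  have w: "w \<in> carrier_vec n" using f Ku by (simp add: w_def)
  have Kw: "K *\<^sub>v w = 0\<^sub>v n"
    using eq K Ku f u by (simp add: w_def mult_minus_distrib_mat_vec[OF K])
  have "w \<bullet> w = f \<bullet> w - (K *\<^sub>v u) \<bullet> w"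
    using minus_scalar_prod_distrib[OF f Ku w] by (simp add: w_def)
  also have "\<dots> = 0"
    using orth[OF w Kw] sym_scalar_prod_comm[OF u w] Kw u by simp
  finally have "w = 0\<^sub>v n" by (rule real_scalar_prod_self_eq_0[OF w])
  have "f = K *\<^sub>v u"
  proof (intro eq_vecI)
    fix i assume "i < dim_vec (K *\<^sub>v u)"
    then show "f $ i = (K *\<^sub>v u) $ i"
      using arg_cong[OF \<open>w = 0\<^sub>v n\<close>, of "\<lambda>x. x $ i"] K f by (simp add: w_def)
  qed (use K f in simp)
  then show ?thesis using u K by (auto simp: mat_image_def)
qed

section \<open>Existence and uniqueness of the pseudo-inverse\<close>

lemma sym_pinv_exists: "\<exists>X. is_pinv K X"
proof -
  have "\<forall>i. \<exists>u\<in>carrier_vec n. K *\<^sub>v unit_vec n i = K *\<^sub>v (K *\<^sub>v u)"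
    using sym_image_square unit_vec_carrier by blast
  then obtain u where u: "\<And>i. u i \<in> carrier_vec n"
    "\<And>i. K *\<^sub>v unit_vec n i = K *\<^sub>v (K *\<^sub>v u i)"
    by metis
  \<comment> \<open>Solving for each unit vector and collecting the solutions as columns gives
    \<open>K (K M) = K\<close>.\<close>
  define M where "M = mat_of_cols n (map u [0..<n])"
  have M: "M \<in> carrier_mat n n" by (simp add: M_def mat_of_cols_def)
  have colM: "col M i = u i" if "i < n" for i
    using that u(1) by (simp add: M_def)
  have KM: "K * M \<in> carrier_mat n n" using K M by simp
  have KKM: "K * (K * M) = K"
  proof (rule eq_matI)
    fix i j assume ij: "i < dim_row K" "j < dim_col K"
    then have j: "j < n" using K by simp
    have "col (K * (K * M)) j = K *\<^sub>v (K *\<^sub>v u j)"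
      by (simp add: col_mult2[OF K KM j] col_mult2[OF K M j] colM[OF j])
    also have "\<dots> = col (K * 1\<^sub>m n) j"
      using u(2)[of j] K j by (subst col_mult2[of _ n n _ n]) auto
    finally have "col (K * (K * M)) j = col K j" using K by simp
    then show "(K * (K * M)) $$ (i, j) = K $$ (i, j)"
      using ij K M by (metis carrier_matD index_col index_mult_mat(2,3))
  qed (use K M in auto)
  define T where "T = transpose_mat M"
  have T: "T \<in> carrier_mat n n" using M by (simp add: T_def)
  have cl: "A * B \<in> carrier_mat n n" if "A \<in> carrier_mat n n" "B \<in> carrier_mat n n" for A B :: "real mat"
    using that by simp
  have asc: "A * B * C = A * (B * C)"
    if "A \<in> carrier_mat n n" "B \<in> carrier_mat n n" "C \<in> carrier_mat n n" for A B C :: "real mat"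
    using that by simp
  have "transpose_mat (K * (K * M)) = T * K * K"
    using K M KM sym by (simp add: transpose_mult[OF K KM] transpose_mult[OF K M] T_def)
  then have TKK: "T * (K * K) = K" using KKM sym asc[OF T K K] by simp
  \<comment> \<open>\<open>T K = T K (K M) = (T K K) M = K M\<close>: the product is its own
    transpose.\<close>
  have KMTK: "K * M = T * K"
    using TKK KKM K M T by (metis asc cl)
  \<comment> \<open>E is the orthogonal projection onto the image of K. The candidate X below
    satisfies \<open>K X = X K = E\<close>, which reduces the Penrose conditions to identities for
    E.\<close>
  define E where "E = K * M"
  have E: "E \<in> carrier_mat n n" using K M by (simp add: E_def)
  have KE: "K * E = K" using KKM by (simp add: E_def)
  have EK: "E * K = K" using TKK KMTK asc[OF T K K] by (simp add: E_def)
  have Esym: "transpose_mat E = E"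
    using transpose_mult[OF K M] sym KMTK by (simp add: E_def T_def)
  have TE: "T * E = E * M" using KMTK K M T by (simp add: E_def asc)
  define X where "X = T * E"
  have X: "X \<in> carrier_mat n n" using T E by (simp add: X_def)
  have KX: "K * X = E"
  proof -
    have "K * X = K * E * M" using TE asc[OF K E M] by (simp add: X_def)
    then show ?thesis by (simp only: KE) (simp add: E_def)
  qed
  have XK: "X * K = E"
    using asc[OF T E K] by (simp add: X_def EK) (simp add: E_def KMTK)
  have EE: "E * E = E"
  proof -
    have "E * E = T * (K * E)" using asc[OF T K E] by (simp add: E_def KMTK)
    then show ?thesis by (simp add: KE) (simp add: E_def KMTK)
  qed
  have EX: "E * X = X"
    using asc[OF E E M] by (simp add: X_def TE EE)
  have "is_pinv K X"
    unfolding is_pinv_def using K X KX XK EX EK Esym by simp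
  then show ?thesis ..
qed

end

text \<open>\<open>A X\<close> and \<open>A Y\<close> are the same orthogonal projection:
  transposing \<open>A Y A X = A X\<close> swaps the two symmetric factors and gives
  \<open>A X A Y = A Y\<close>. The same holds for \<open>X A\<close> and \<open>Y A\<close>, and
  then \<open>X = X A X = Y A Y = Y\<close>.\<close>

lemma is_pinv_unique:
  assumes "is_pinv A X" "is_pinv A Y"
  shows "X = Y"
proof -
  obtain m n where A: "A \<in> carrier_mat m n" by blast
  have X: "X \<in> carrier_mat n m" and Y: "Y \<in> carrier_mat n m"
    using A assms by (auto simp: is_pinv_def)
  have AXY: "A * X = A * Y"
  proof -
    have "A * X = A * Y * A * X" using assms(2) by (simp add: is_pinv_def)
    also have "\<dots> = A * Y * (A * X)" by (rule assoc_mult_mat) (use A X Y in auto)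
    finally have "A * X = transpose_mat (A * Y * (A * X))"
      using assms(1) by (simp add: is_pinv_def)
    also have "\<dots> = A * X * (A * Y)"
      using assms A X Y by (subst transpose_mult[of _ m m _ m]) (auto simp: is_pinv_def)
    also have "\<dots> = A * X * A * Y"
      by (rule assoc_mult_mat[symmetric]) (use A X Y in auto)
    also have "\<dots> = A * Y" using assms(1) by (simp add: is_pinv_def)
    finally show ?thesis .
  qed
  have XYA: "X * A = Y * A"
  proof -
    have "X * A = X * (A * Y * A)" using assms(2) by (simp add: is_pinv_def)
    also have "\<dots> = X * A * (Y * A)"
      using A X Y by (simp add: assoc_mult_mat[of X n m A n "Y * A" n] assoc_mult_mat[of A m n Y m A n])
    finally have "X * A = transpose_mat (X * A * (Y * A))"
      using assms(1) by (simp add: is_pinv_def)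
    also have "\<dots> = Y * A * (X * A)"
      using assms A X Y by (subst transpose_mult[of _ n n _ n]) (auto simp: is_pinv_def)
    also have "\<dots> = Y * (A * X * A)"
      using A X Y by (simp add: assoc_mult_mat[of Y n m A n "X * A" n] assoc_mult_mat[of A m n X m A n])
    also have "\<dots> = Y * A" using assms(1) by (simp add: is_pinv_def)
    finally show ?thesis .
  qed
  have "X = X * A * X" using assms by (simp add: is_pinv_def)
  also have "\<dots> = Y * A * Y"
    using A X Y AXY XYA by (metis assoc_mult_mat)
  also have "\<dots> = Y" using assms by (simp add: is_pinv_def)
  finally show ?thesis .
qed

lemma is_pinv_pinv:
  assumes "K \<in> carrier_mat n n" "transpose_mat K = K"
  shows "is_pinv K (pinv K)"
proof -
  obtain X where X: "is_pinv K X" using sym_pinv_exists[OF assms] by (rule exE)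
  then show ?thesis
    unfolding pinv_def by (rule theI[of "is_pinv K"]) (rule is_pinv_unique[OF _ X])
qed

section \<open>Quadratic forms\<close>

definition qform :: "real mat \<Rightarrow> real vec \<Rightarrow> real" where
  "qform A v = v \<bullet> (A *\<^sub>v v)"

lemma qform_sum:
  assumes "A \<in> carrier_mat n n" "v \<in> carrier_vec n"
  shows "qform A v = (\<Sum>p<n. \<Sum>q<n. A $$ (p, q) * (v $ p * v $ q))"
  using assms unfolding qform_def
  by (simp add: scalar_prod_def sum_distrib_left atLeast0LessThan mult_ac)

lemma psd_qform_nonneg:
  "psd A \<Longrightarrow> A \<in> carrier_mat n n \<Longrightarrow> v \<in> carrier_vec n \<Longrightarrow> 0 \<le> qform A v"
  by (auto simp: psd_def qform_def)

lemma qform_smult: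
  assumes "A \<in> carrier_mat n n" "v \<in> carrier_vec n"
  shows "qform A (t \<cdot>\<^sub>v v) = t\<^sup>2 * qform A v"
  using assms by (simp add: qform_def mult_mat_vec[of _ n n] power2_eq_square)

text \<open>By symmetry the left side is \<open>u . K K^+ K u\<close> with \<open>K^+\<close> the
  pseudo-inverse, and \<open>K K^+ K = K\<close>. The compliance can thus be read off any
  equilibrium displacement.\<close>

lemma pinv_scalar_prod:
  assumes K: "K \<in> carrier_mat n n" and sym: "transpose_mat K = K"
    and u: "u \<in> carrier_vec n" and f: "f = K *\<^sub>v u"
  shows "f \<bullet> (pinv K *\<^sub>v f) = f \<bullet> u"
proof -
  have X: "pinv K \<in> carrier_mat n n" "K * pinv K * K = K"
    using is_pinv_pinv[OF K sym] K by (auto simp: is_pinv_def)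
  have Xf: "pinv K *\<^sub>v f \<in> carrier_vec n" using X f K u by simp
  have "f \<bullet> (pinv K *\<^sub>v f) = u \<bullet> (K *\<^sub>v (pinv K *\<^sub>v f))"
    using sym_scalar_prod_comm[OF K sym u Xf] f by simp
  also have "K *\<^sub>v (pinv K *\<^sub>v f) = (K * pinv K * K) *\<^sub>v u"
    using K X(1) u by (simp add: f assoc_mult_mat_vec[of _ n n _ n])
  also have "\<dots> = f" by (simp add: X f)
  finally show ?thesis using u K by (simp add: f comm_scalar_prod[of _ n])
qed

lemma zero_if_multiples_bounded:
  fixes x c :: real
  assumes "\<And>t. 2 * (t * x) \<le> c"
  shows "x = 0"
proof (rule ccontr)
  assume "x \<noteq> 0"
  \<comment> \<open>At this t the left side equals 2 (|c| + 1), which exceeds c.\<close>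
  then show False using assms[of "(\<bar>c\<bar> + 1) / x"] by simp
qed

text \<open>Completing the square at a solution u of \<open>f = K u\<close> gives
  \<open>2 f . v - q(v) = f . u - q(u - v)\<close>, with maximum \<open>f . u\<close> at
  \<open>v = u\<close>. Conversely, on a kernel direction the quadratic part vanishes, so the bound
  on all its multiples makes f orthogonal to the kernel and hence an element of the image.\<close>

lemma compliance_form_le_iff:
  fixes f :: "real vec"
  assumes K: "K \<in> carrier_mat n n" and psd: "psd K" and f: "f \<in> carrier_vec n"
  shows "f \<in> mat_image K \<and> f \<bullet> (pinv K *\<^sub>v f) \<le> c \<longleftrightarrow>
    (\<forall>v\<in>carrier_vec n. 2 * (f \<bullet> v) - qform K v \<le> c)"
proof -
  have sym: "transpose_mat K = K" using psd by (simp add: psd_def)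
  have id: "2 * (f \<bullet> v) - qform K v = f \<bullet> u - qform K (u - v)"
    if u: "u \<in> carrier_vec n" "f = K *\<^sub>v u" and v: "v \<in> carrier_vec n" for u v
  proof -
    have "qform K (u - v) = u \<bullet> (K *\<^sub>v u) - u \<bullet> (K *\<^sub>v v) - v \<bullet> (K *\<^sub>v u) + qform K v"
      using K u(1) v unfolding qform_def
      by (simp add: mult_minus_distrib_mat_vec[OF K] minus_scalar_prod_distrib[of _ n]
          scalar_prod_minus_distrib[of _ n])
    also have "u \<bullet> (K *\<^sub>v v) = f \<bullet> v" using sym_scalar_prod_comm[OF K sym u(1) v] u(2) by simp
    also have "u \<bullet> (K *\<^sub>v u) = f \<bullet> u" using sym_scalar_prod_comm[OF K sym u(1) u(1)] u(2) by simp
    also have "v \<bullet> (K *\<^sub>v u) = f \<bullet> v" using f v u(2) by (metis comm_scalar_prod)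
    finally show ?thesis by simp
  qed
  show ?thesis
  proof (intro iffI ballI)
    fix v :: "real vec" assume l: "f \<in> mat_image K \<and> f \<bullet> (pinv K *\<^sub>v f) \<le> c" and v: "v \<in> carrier_vec n"
    from l obtain u where u: "u \<in> carrier_vec n" "f = K *\<^sub>v u" using K by (auto simp: mat_image_def)
    show "2 * (f \<bullet> v) - qform K v \<le> c"
      using id[OF u v] l pinv_scalar_prod[OF K sym u] psd_qform_nonneg[OF psd K, of "u - v"] u v by simp
  next
    assume r: "\<forall>v\<in>carrier_vec n. 2 * (f \<bullet> v) - qform K v \<le> c"
    have im: "f \<in> mat_image K"
    proof (rule sym_mat_image_if_orthogonal_kernel[OF K sym f])
      fix v assume v: "v \<in> carrier_vec n" "K *\<^sub>v v = 0\<^sub>v n"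
      show "f \<bullet> v = 0"
      proof (rule zero_if_multiples_bounded)
        fix t
        have "qform K (t \<cdot>\<^sub>v v) = 0"
          using v by (simp add: qform_smult[OF K v(1)]) (simp add: qform_def)
        then show "2 * (t * (f \<bullet> v)) \<le> c" using bspec[OF r, of "t \<cdot>\<^sub>v v"] v f by simp
      qed
    qed
    then obtain u where u: "u \<in> carrier_vec n" "f = K *\<^sub>v u" using K by (auto simp: mat_image_def)
    have "f \<bullet> u - qform K (u - u) \<le> c" using r id[OF u u(1)] u(1) by metis
    moreover have "qform K (u - u) = 0" using u(1) K by (simp add: qform_def)
    ultimately show "f \<in> mat_image K \<and> f \<bullet> (pinv K *\<^sub>v f) \<le> c"
      using im pinv_scalar_prod[OF K sym u] by simp
  qed
qed

section \<open>Moments and localizing matrices\<close>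

lemma riesz_superset:
  assumes "finite S" "Poly_Mapping.keys p \<subseteq> S"
  shows "riesz y p = (\<Sum>m\<in>S. Poly_Mapping.lookup p m * y m)"
  unfolding riesz_def using assms by (intro sum.mono_neutral_left) (auto simp: in_keys_iff)

lemma riesz_add: "riesz y (p + q) = riesz y p + riesz y q"
proof -
  let ?S = "Poly_Mapping.keys p \<union> Poly_Mapping.keys q"
  have "Poly_Mapping.keys (p + q) \<subseteq> ?S" by (rule keys_add)
  then show ?thesis
    by (simp add: riesz_superset[of ?S] lookup_add algebra_simps sum.distrib)
qed

lemma riesz_zero [simp]: "riesz y 0 = 0"
  by (simp add: riesz_def)

lemma riesz_uminus: "riesz y (- p) = - riesz y p"
  using riesz_add[of y p "- p"] by simp

lemma riesz_sum: "riesz y (sum f S) = (\<Sum>x\<in>S. riesz y (f x))"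
  by (induction S rule: infinite_finite_induct) (auto simp: riesz_add)

lemma riesz_single: "riesz y (Poly_Mapping.single m c) = c * y m"
  by (simp add: riesz_def)

lemma pconst_mult_lookup: "Poly_Mapping.lookup (pconst c * p) m = c * Poly_Mapping.lookup p m"
proof -
  have "pconst c * p = Poly_Mapping.map ((*) c) p"
    unfolding pconst_def by (rule mult_map_scale_conv_mult[symmetric])
  then show ?thesis by (simp add: Poly_Mapping.map.rep_eq when_def)
qed

lemma riesz_pconst_mult: "riesz y (pconst c * p) = c * riesz y p"
proof -
  have "Poly_Mapping.keys (pconst c * p) \<subseteq> Poly_Mapping.keys p"
    by (auto simp: in_keys_iff pconst_mult_lookup)
  then show ?thesis
    by (simp add: riesz_superset[of "Poly_Mapping.keys p"] pconst_mult_lookup sum_distrib_left mult.assoc)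
qed

lemma pconst_mult: "pconst a * pconst b = pconst (a * b)"
  by (simp add: pconst_def mult_single)

lemma pconst_1: "pconst 1 = 1"
  by (simp add: pconst_def)

lemma pconst_power: "pconst a ^ k = pconst (a ^ k)"
  by (induction k) (auto simp: pconst_mult pconst_1)

lemma pvar_power: "pvar e ^ k = Poly_Mapping.single (Poly_Mapping.single e k) 1"
  by (induction k) (auto simp: pvar_def mvar_def mult_single single_add[symmetric])

text \<open>The Riesz functional applied to the i-th power of the substituted area \<alpha> (x_e +
  1), expanded binomially; \<alpha> will be \<open>w / (2 * (dens D e * len D e))\<close>. For
  \<open>i = 1\<close> and \<open>y 0 = 1\<close> it is the recovered area.\<close>

definition area_moment :: "real \<Rightarrow> nat \<Rightarrow> (monomial \<Rightarrow> real) \<Rightarrow> nat \<Rightarrow> real" where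
  "area_moment \<alpha> e y i =
     \<alpha> ^ i * (\<Sum>k\<le>i. real (i choose k) * y (Poly_Mapping.single e k))"

lemma riesz_S_area_power:
  "riesz y (S_area D w e ^ i) = area_moment (w / (2 * (dens D e * len D e))) e y i"
proof -
  define \<alpha> where "\<alpha> = w / (2 * (dens D e * len D e))"
  have "S_area D w e = pconst (1 / 2) * pconst (w / (dens D e * len D e)) * (pvar e + 1)"
    by (simp add: S_area_def mult_ac)
  also have "\<dots> = pconst \<alpha> * (pvar e + 1)"
    by (simp add: pconst_mult \<alpha>_def)
  finally have "S_area D w e ^ i = pconst (\<alpha> ^ i) * (pvar e + 1) ^ i"
    by (simp add: power_mult_distrib pconst_power)
  also have "(pvar e + 1) ^ i = (\<Sum>k\<le>i. of_nat (i choose k) * pvar e ^ k)"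
    by (simp add: binomial_ring)
  also have "\<dots> = (\<Sum>k\<le>i. Poly_Mapping.single (Poly_Mapping.single e k) (real (i choose k)))"
    by (simp add: pvar_power of_nat_single mult_single del: single_of_nat)
  finally show ?thesis
    by (simp add: riesz_pconst_mult riesz_sum riesz_single area_moment_def \<alpha>_def)
qed

lemma riesz_S_stiffness:
  assumes "p < ndof D j" "q < ndof D j"
  shows "riesz y (S_stiffness D w j $$ (p, q)) = stiff0 D j $$ (p, q) * y 0 +
    (\<Sum>e<num_el D. \<Sum>i=1..3. stiffc D j i e $$ (p, q) *
       area_moment (w / (2 * (dens D e * len D e))) e y i)"
  using assms
  by (simp add: S_stiffness_def riesz_add riesz_sum riesz_pconst_mult riesz_S_area_power)
    (simp add: pconst_def riesz_single)

section \<open>Degrees, coefficients and diagonal blocks of polynomial matrices\<close>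

lemma mdeg_le_pdeg:
  assumes "Poly_Mapping.lookup p m \<noteq> 0"
  shows "mdeg m \<le> pdeg p"
  unfolding pdeg_def using assms by (intro Max_ge) (auto simp: in_keys_iff)

lemma mdeg_single: "mdeg (Poly_Mapping.single e k) = k"
  by (simp add: mdeg_def)

lemma mdeg_le_pmat_degree:
  assumes "p < dim_row G" "q < dim_col G" "Poly_Mapping.lookup (G $$ (p, q)) m \<noteq> 0"
  shows "mdeg m \<le> pmat_degree G"
proof -
  let ?S = "{pdeg (G $$ (p, q)) | p q. p < dim_row G \<and> q < dim_col G}"
  have "?S = (\<lambda>(p, q). pdeg (G $$ (p, q))) ` ({..<dim_row G} \<times> {..<dim_col G})" by auto
  then have "finite ?S" by simp
  then have "pdeg (G $$ (p, q)) \<le> pmat_degree G"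
    unfolding pmat_degree_def using assms by (intro Max_ge) auto
  then show ?thesis using mdeg_le_pdeg[OF assms(3)] by simp
qed

text \<open>Makes the Riesz formulas available for computing coefficients, by taking the indicator
  of one monomial as the moment sequence. The degree bounds below rest on this.\<close>

lemma lookup_conv_riesz:
  "Poly_Mapping.lookup p m = riesz (\<lambda>m'. if m' = m then 1 else 0) p"
  by (subst riesz_superset[of "insert m (Poly_Mapping.keys p)"])
    (auto simp: if_distrib sum.If_cases cong: if_cong)

text \<open>Since the blocks are square, the row and column offsets of a block agree and a single
  \<open>off\<close> serves both.\<close>

lemma diag_block_mat_entries:
  assumes "k < length As" "\<And>A. A \<in> set As \<Longrightarrow> square_mat A"
  shows "\<exists>off. off + dim_row (As ! k) \<le> dim_row (diag_block_mat As) \<and>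
    (\<forall>p<dim_row (As ! k). \<forall>q<dim_row (As ! k).
       diag_block_mat As $$ (off + p, off + q) = As ! k $$ (p, q))"
  using assms
proof (induction As arbitrary: k)
  case (Cons A As)
  have sq: "dim_col (diag_block_mat As) = dim_row (diag_block_mat As)"
    using diag_block_mat_square[of As] Cons.prems(2) by auto
  have A: "dim_col A = dim_row A" using Cons.prems(2)[of A] by simp
  show ?case
  proof (cases k)
    case 0
    then show ?thesis using A sq by (intro exI[of _ 0]) (auto simp: Let_def)
  next
    case (Suc l)
    then have "l < length As" using Cons.prems(1) by simp
    with Cons.IH Cons.prems(2) obtain off where "off + dim_row (As ! l) \<le> dim_row (diag_block_mat As)"
      "\<forall>p<dim_row (As ! l). \<forall>q<dim_row (As ! l).
         diag_block_mat As $$ (off + p, off + q) = As ! l $$ (p, q)"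
      by (meson list.set_intros(2))
    then show ?thesis
      using Suc A sq by (intro exI[of _ "dim_row A + off"]) (auto simp: Let_def)
  qed
qed simp

section \<open>Moment and localizing matrices as quadratic forms\<close>

lemma psd_form_nonneg:
  assumes psd: "psd A" and \<iota>: "\<And>a. a < m \<Longrightarrow> \<iota> a < dim_row A"
  shows "0 \<le> (\<Sum>a<m. \<Sum>b<m. A $$ (\<iota> a, \<iota> b) * (x a * x b))"
proof -
  define N where "N = dim_row A"
  have A: "A \<in> carrier_mat N N" using psd by (auto simp: N_def psd_def)
  \<comment> \<open>The weights x are pushed forward along \<iota>; where \<iota> repeats an index,
    they add up.\<close>
  define v where "v = vec N (\<lambda>p. \<Sum>a<m. if \<iota> a = p then x a else 0)"
  have "v \<bullet> (A *\<^sub>v v) = (\<Sum>p<N. \<Sum>q<N. A $$ (p, q) * (v $ p * v $ q))"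
    using qform_sum[OF A, of v] by (simp add: qform_def v_def)
  also have "\<dots> = (\<Sum>p<N. \<Sum>q<N. \<Sum>a<m. \<Sum>b<m.
      if \<iota> a = p then if \<iota> b = q then A $$ (p, q) * (x a * x b) else 0 else 0)"
  proof (intro sum.cong refl)
    fix p q assume "p \<in> {..<N}" "q \<in> {..<N}"
    then have "v $ p = (\<Sum>a<m. if \<iota> a = p then x a else 0)"
      and "v $ q = (\<Sum>a<m. if \<iota> a = q then x a else 0)"
      by (simp_all add: v_def)
    then show "A $$ (p, q) * (v $ p * v $ q) = (\<Sum>a<m. \<Sum>b<m.
        if \<iota> a = p then if \<iota> b = q then A $$ (p, q) * (x a * x b) else 0 else 0)"
      by (simp only: sum_product) (simp only: sum_distrib_left, intro sum.cong refl, simp)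
  qed
  also have "\<dots> = (\<Sum>a<m. \<Sum>b<m. \<Sum>p<N. \<Sum>q<N.
      if \<iota> a = p then if \<iota> b = q then A $$ (p, q) * (x a * x b) else 0 else 0)"
    by (simp only: sum.swap[of _ "{..<m}" "{..<N}"])
  also have "\<dots> = (\<Sum>a<m. \<Sum>b<m. A $$ (\<iota> a, \<iota> b) * (x a * x b))"
  proof (intro sum.cong refl)
    fix a b assume "a \<in> {..<m}" "b \<in> {..<m}"
    then have "\<iota> a < N" "\<iota> b < N" using \<iota> by (auto simp: N_def)
    then show "(\<Sum>p<N. \<Sum>q<N.
        if \<iota> a = p then if \<iota> b = q then A $$ (p, q) * (x a * x b) else 0 else 0) =
        A $$ (\<iota> a, \<iota> b) * (x a * x b)"
      by (subst sum.mono_neutral_right[of _ "{\<iota> a}"])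
        (auto simp: sum.delta)
  qed
  finally have eq: "v \<bullet> (A *\<^sub>v v) = (\<Sum>a<m. \<Sum>b<m. A $$ (\<iota> a, \<iota> b) * (x a * x b))" .
  have "v \<in> carrier_vec (dim_row A)" by (simp add: v_def N_def)
  then have "0 \<le> v \<bullet> (A *\<^sub>v v)" using psd unfolding psd_def by blast
  then show ?thesis by (simp only: eq)
qed

lemma mon_vec_index:
  assumes "m \<in> monomials n k"
  shows "\<exists>p<dim_vec (mon_vec n k). mon_vec n k $ p = Poly_Mapping.single m 1"
proof -
  let ?l = "sorted_list_of_set (monomials n k)"
  have "m \<in> set ?l" using assms by (simp add: finite_monomials)
  then obtain p where "p < length ?l" "?l ! p = m" by (auto simp: in_set_conv_nth)
  then show ?thesis by (intro exI[of _ p]) (simp add: mon_vec_def vec_of_list_index)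
qed

text \<open>Selecting the monomials by name means that their positions in the sorted list behind
  \<open>mon_vec\<close> never have to be computed.\<close>

lemma moment_form_nonneg:
  assumes psd: "psd (moment_mat n k y)" and ms: "\<And>a. a < N \<Longrightarrow> ms a \<in> monomials n (k div 2)"
  shows "0 \<le> (\<Sum>a<N. \<Sum>b<N. y (ms a + ms b) * (x a * x b))"
proof -
  let ?b = "mon_vec n (k div 2)"
  have "\<forall>a. \<exists>p. a < N \<longrightarrow> p < dim_vec ?b \<and> ?b $ p = Poly_Mapping.single (ms a) 1"
    using mon_vec_index[OF ms] by blast
  then obtain \<iota> where \<iota>: "\<And>a. a < N \<Longrightarrow> \<iota> a < dim_vec ?b"
    "\<And>a. a < N \<Longrightarrow> ?b $ \<iota> a = Poly_Mapping.single (ms a) 1"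
    by metis
  have "0 \<le> (\<Sum>a<N. \<Sum>b<N. moment_mat n k y $$ (\<iota> a, \<iota> b) * (x a * x b))"
    using \<iota> by (intro psd_form_nonneg[OF psd]) (simp add: moment_mat_def mon_outer_def)
  also have "\<dots> = (\<Sum>a<N. \<Sum>b<N. y (ms a + ms b) * (x a * x b))"
    using \<iota> by (intro sum.cong) (auto simp: moment_mat_def mon_outer_def mult_single riesz_single)
  finally show ?thesis .
qed

lemma zero_in_monomials: "0 \<in> monomials n k"
  by (simp add: monomials_def mdeg_def)

lemma localizing_form_nonneg:
  assumes psd: "psd (localizing_mat n k G y)" and G: "dim_col G = dim_row G"
    and \<iota>: "\<And>a. a < N \<Longrightarrow> \<iota> a < dim_row G"
  shows "0 \<le> (\<Sum>a<N. \<Sum>b<N. riesz y (G $$ (\<iota> a, \<iota> b)) * (x a * x b))"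
proof -
  let ?b = "mon_vec n (k div 2)"
  \<comment> \<open>Only the diagonal block of the monomial 1 is used: there the localizing matrix
    is G with the Riesz functional applied entrywise.\<close>
  obtain p where p: "p < dim_vec ?b" "?b $ p = 1"
    using mon_vec_index[OF zero_in_monomials] by force
  have lt: "p * dim_row G + \<iota> a < dim_vec ?b * dim_row G" if "a < N" for a
  proof -
    have "p * dim_row G + \<iota> a < Suc p * dim_row G" using \<iota>[OF that] by simp
    also have "\<dots> \<le> dim_vec ?b * dim_row G" using p(1) by (intro mult_le_mono1) simp
    finally show ?thesis .
  qed
  have "0 \<le> (\<Sum>a<N. \<Sum>b<N.
      localizing_mat n k G y $$ (p * dim_row G + \<iota> a, p * dim_row G + \<iota> b) * (x a * x b))"
    using lt by (intro psd_form_nonneg[OF psd])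
      (simp add: localizing_mat_def kronecker_def mon_outer_def)
  also have "\<dots> = (\<Sum>a<N. \<Sum>b<N. riesz y (G $$ (\<iota> a, \<iota> b)) * (x a * x b))"
  proof (intro sum.cong refl)
    fix a b assume "a \<in> {..<N}" "b \<in> {..<N}"
    then have "\<iota> a < dim_row G" "\<iota> b < dim_row G" using \<iota> by auto
    then have "(p * dim_row G + \<iota> a) div dim_row G = p" "(p * dim_row G + \<iota> b) div dim_row G = p"
      by (metis add.commute div_mult_self3 div_less add_0_right less_nat_zero_code)+
    with \<open>a \<in> {..<N}\<close> \<open>b \<in> {..<N}\<close>
    show "localizing_mat n k G y $$ (p * dim_row G + \<iota> a, p * dim_row G + \<iota> b) * (x a * x b) =
        riesz y (G $$ (\<iota> a, \<iota> b)) * (x a * x b)"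
      using lt \<iota> p G by (simp add: localizing_mat_def kronecker_def mon_outer_def)
  qed
  finally show ?thesis .
qed

lemma single_in_monomials:
  assumes "e < n" "i \<le> k"
  shows "Poly_Mapping.single e i \<in> monomials n k"
  using assms by (cases "i = 0") (auto simp: monomials_def mdeg_single zero_in_monomials mdeg_def)

section \<open>Stiffness forms and the univariate problem\<close>

text \<open>The coefficients c are arbitrary so that the formula covers both the stiffness matrix,
  with powers of the areas, and its linearization, with area moments.\<close>

lemma qform_combination:
  assumes v: "v \<in> carrier_vec n" and A: "A \<in> carrier_mat n n"
    and B: "\<And>e i. e < N \<Longrightarrow> i \<in> I \<Longrightarrow> B i e \<in> carrier_mat n n"
  shows "qform (mat n n (\<lambda>pq. A $$ pq + (\<Sum>e<N. \<Sum>i\<in>I. B i e $$ pq * c e i))) v =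
    qform A v + (\<Sum>e<N. \<Sum>i\<in>I. c e i * qform (B i e) v)"
proof -
  have "qform (mat n n (\<lambda>pq. A $$ pq + (\<Sum>e<N. \<Sum>i\<in>I. B i e $$ pq * c e i))) v =
    qform A v + (\<Sum>p<n. \<Sum>q<n. \<Sum>e<N. \<Sum>i\<in>I. c e i * (B i e $$ (p, q) * (v $ p * v $ q)))"
    by (subst (1 2) qform_sum[OF _ v])
      (simp_all add: A distrib_left distrib_right sum.distrib sum_distrib_left sum_distrib_right mult_ac)
  also have "(\<Sum>p<n. \<Sum>q<n. \<Sum>e<N. \<Sum>i\<in>I. c e i * (B i e $$ (p, q) * (v $ p * v $ q))) =
    (\<Sum>e<N. \<Sum>p<n. \<Sum>q<n. \<Sum>i\<in>I. c e i * (B i e $$ (p, q) * (v $ p * v $ q)))"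
    by (simp only: sum.swap[of _ "{..<N}" "{..<n}"])
  also have "\<dots> = (\<Sum>e<N. \<Sum>i\<in>I. \<Sum>p<n. \<Sum>q<n. c e i * (B i e $$ (p, q) * (v $ p * v $ q)))"
    by (simp only: sum.swap[of _ I "{..<n}"])
  also have "\<dots> = (\<Sum>e<N. \<Sum>i\<in>I. c e i * qform (B i e) v)"
    by (intro sum.cong refl) (simp add: qform_sum[OF B v] sum_distrib_left)
  finally show ?thesis .
qed

context
  fixes D :: weight_data
  assumes valid: "valid_data D"
begin

lemma data_props:
  assumes "j < num_lc D"
  shows "force D j \<in> carrier_vec (ndof D j)" "stiff0 D j \<in> carrier_mat (ndof D j) (ndof D j)"
    "psd (stiff0 D j)"
    "e < num_el D \<Longrightarrow> i \<in> {1..3} \<Longrightarrow> stiffc D j i e \<in> carrier_mat (ndof D j) (ndof D j)"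
    "e < num_el D \<Longrightarrow> i \<in> {1..3} \<Longrightarrow> psd (stiffc D j i e)"
  using valid assms unfolding valid_data_def by blast+

lemma element_pos: "e < num_el D \<Longrightarrow> 0 < dens D e * len D e"
  using valid unfolding valid_data_def by simp

lemma stiffness_carrier: "stiffness D j a \<in> carrier_mat (ndof D j) (ndof D j)"
  by (simp add: stiffness_def)

lemma qform_stiffness:
  assumes "j < num_lc D" "v \<in> carrier_vec (ndof D j)"
  shows "qform (stiffness D j a) v = qform (stiff0 D j) v +
    (\<Sum>e<num_el D. \<Sum>i=1..3. (a $ e) ^ i * qform (stiffc D j i e) v)"
  unfolding stiffness_def
  by (rule qform_combination) (use assms data_props in auto)

lemma qform_stiffc_nonneg:
  assumes "j < num_lc D" "v \<in> carrier_vec (ndof D j)" "e < num_el D" "i \<in> {1..3}"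
  shows "0 \<le> qform (stiffc D j i e) v"
  using assms data_props by (intro psd_qform_nonneg[of _ "ndof D j"]) auto

lemma qform_stiff0_nonneg:
  assumes "j < num_lc D" "v \<in> carrier_vec (ndof D j)"
  shows "0 \<le> qform (stiff0 D j) v"
  using assms data_props by (intro psd_qform_nonneg[of _ "ndof D j"]) auto

lemma psd_stiffness:
  assumes j: "j < num_lc D" and a: "nonneg_vec (num_el D) a"
  shows "psd (stiffness D j a)"
proof -
  have symI: "A $$ (q, p) = A $$ (p, q)"
    if "psd A" "A \<in> carrier_mat (ndof D j) (ndof D j)" "p < ndof D j" "q < ndof D j" for A p q
    using that unfolding psd_def by (metis carrier_matD index_transpose_mat(1))
  have "transpose_mat (stiffness D j a) = stiffness D j a"
    using symI[OF data_props(3,2)[OF j]] symI[OF data_props(5,4)[OF j]]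
    by (intro eq_matI) (auto simp: stiffness_def)
  moreover have "0 \<le> v \<bullet> (stiffness D j a *\<^sub>v v)" if v: "v \<in> carrier_vec (ndof D j)" for v
  proof -
    have "0 \<le> qform (stiffness D j a) v"
      unfolding qform_stiffness[OF j v] using a j v
      by (intro add_nonneg_nonneg sum_nonneg mult_nonneg_nonneg zero_le_power
          qform_stiff0_nonneg qform_stiffc_nonneg) (auto simp: nonneg_vec_def)
    then show ?thesis by (simp add: qform_def)
  qed
  ultimately show ?thesis using stiffness_carrier[of j a] by (auto simp: psd_def)
qed

lemma qform_stiffness_zeroD:
  assumes j: "j < num_lc D" and a: "nonneg_vec (num_el D) a" and v: "v \<in> carrier_vec (ndof D j)"
    and zero: "qform (stiffness D j a) v = 0"
  shows "qform (stiff0 D j) v = 0"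
    and "e < num_el D \<Longrightarrow> i \<in> {1..3} \<Longrightarrow> a $ e \<noteq> 0 \<Longrightarrow> qform (stiffc D j i e) v = 0"
proof -
  let ?t = "\<lambda>e i. (a $ e) ^ i * qform (stiffc D j i e) v"
  have t: "0 \<le> ?t e i" if "e < num_el D" "i \<in> {1..3}" for e i
    using a that by (intro mult_nonneg_nonneg qform_stiffc_nonneg[OF j v]) (auto simp: nonneg_vec_def)
  then have s: "0 \<le> (\<Sum>i=1..3. ?t e i)" if "e < num_el D" for e
    using that by (intro sum_nonneg t)
  then have "0 \<le> (\<Sum>e<num_el D. \<Sum>i=1..3. ?t e i)" by (intro sum_nonneg s) auto
  then have z: "qform (stiff0 D j) v = 0" "(\<Sum>e<num_el D. \<Sum>i=1..3. ?t e i) = 0"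
    using zero qform_stiff0_nonneg[OF j v] unfolding qform_stiffness[OF j v] by linarith+
  show "qform (stiff0 D j) v = 0" by (rule z(1))
  assume e: "e < num_el D" "i \<in> {1..3}" "a $ e \<noteq> 0"
  then have "(\<Sum>i=1..3. ?t e i) = 0" using z(2) s by (subst (asm) sum_nonneg_eq_0_iff) auto
  then have "?t e i = 0" using t e by (subst (asm) sum_nonneg_eq_0_iff) auto
  then show "qform (stiffc D j i e) v = 0" using e(3) by simp
qed

text \<open>The bound may involve coefficients c other than the powers of a, as long as no term
  survives where a vanishes. A kernel vector of the stiffness matrix at a then makes the whole
  quadratic part zero, and scaling that vector forces \<open>f . v = 0\<close>.\<close>

lemma force_in_image_if_supported:
  assumes j: "j < num_lc D" and a: "nonneg_vec (num_el D) a"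
    and bound: "\<And>v. v \<in> carrier_vec (ndof D j) \<Longrightarrow> 2 * (force D j \<bullet> v) - (qform (stiff0 D j) v +
        (\<Sum>e<num_el D. \<Sum>i=1..3. c e i * qform (stiffc D j i e) v)) \<le> C"
    and supp: "\<And>e i v. e < num_el D \<Longrightarrow> i \<in> {1..3} \<Longrightarrow> a $ e = 0 \<Longrightarrow>
        v \<in> carrier_vec (ndof D j) \<Longrightarrow> c e i * qform (stiffc D j i e) v = 0"
  shows "force D j \<in> mat_image (stiffness D j a)"
proof (rule sym_mat_image_if_orthogonal_kernel[OF stiffness_carrier])
  show "transpose_mat (stiffness D j a) = stiffness D j a"
    using psd_stiffness[OF j a] by (simp add: psd_def)
  show "force D j \<in> carrier_vec (ndof D j)" by (rule data_props(1)[OF j])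
  fix v assume v: "v \<in> carrier_vec (ndof D j)" and "stiffness D j a *\<^sub>v v = 0\<^sub>v (ndof D j)"
  then have "qform (stiffness D j a) v = 0" by (simp add: qform_def)
  note zero = qform_stiffness_zeroD[OF j a v this]
  show "force D j \<bullet> v = 0"
  proof (rule zero_if_multiples_bounded)
    fix t
    have "c e i * qform (stiffc D j i e) (t \<cdot>\<^sub>v v) = 0" if "e < num_el D" "i \<in> {1..3}" for e i
      using that zero(2)[OF that] supp[OF that _ v]
      by (cases "a $ e = 0") (auto simp: qform_smult[OF data_props(4)[OF j that] v])
    then have "(\<Sum>e<num_el D. \<Sum>i=1..3. c e i * qform (stiffc D j i e) (t \<cdot>\<^sub>v v)) = 0"
      by (intro sum.neutral ballI) auto
    then show "2 * (t * (force D j \<bullet> v)) \<le> C"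
      using bound[of "t \<cdot>\<^sub>v v"] v zero(1) data_props(1)[OF j]
      by (simp add: qform_smult[OF data_props(2)[OF j] v])
  qed
qed

lemma compliance_le_iff:
  assumes j: "j < num_lc D" and a: "nonneg_vec (num_el D) a"
  shows "force D j \<in> mat_image (stiffness D j a) \<and> compliance D j a \<le> c \<longleftrightarrow>
    (\<forall>v\<in>carrier_vec (ndof D j). 2 * (force D j \<bullet> v) - qform (stiffness D j a) v \<le> c)"
  unfolding compliance_def
  by (rule compliance_form_le_iff[OF stiffness_carrier psd_stiffness[OF j a] data_props(1)[OF j]])

section \<open>Scaling a design and the univariate problem\<close>

lemma nonneg_vec_smult: "nonneg_vec n a \<Longrightarrow> 0 \<le> \<delta> \<Longrightarrow> nonneg_vec n (\<delta> \<cdot>\<^sub>v a)"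
  by (auto simp: nonneg_vec_def)

text \<open>A positive factor leaves the set of zero areas unchanged, so the variational bound at a,
  with its own compliance as constant, is supported on the scaled design.\<close>

lemma force_in_image_smult:
  assumes dom: "compliance_domain D a" and j: "j < num_lc D" and \<delta>: "\<delta> > 0"
  shows "force D j \<in> mat_image (stiffness D j (\<delta> \<cdot>\<^sub>v a))"
proof -
  have a: "nonneg_vec (num_el D) a" and "force D j \<in> mat_image (stiffness D j a)"
    using dom j by (auto simp: compliance_domain_def)
  then have "2 * (force D j \<bullet> v) - qform (stiffness D j a) v \<le> compliance D j a"
    if "v \<in> carrier_vec (ndof D j)" for v
    using compliance_le_iff[OF j a] that by blast
  then show ?thesis
    using a \<delta>
    by (intro force_in_image_if_supported[OF j nonneg_vec_smult, where c = "\<lambda>e i. (a $ e) ^ i"])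
      (auto simp: qform_stiffness[OF j] nonneg_vec_def)
qed

text \<open>The variational form of the compliance constraint at the scaled design, with the image
  condition built in. It remains usable at \<delta> = 0, where the force may leave the
  image.\<close>

definition scaled_bound :: "real vec \<Rightarrow> nat \<Rightarrow> real \<Rightarrow> bool" where
  "scaled_bound a j \<delta> \<longleftrightarrow> (\<forall>v\<in>carrier_vec (ndof D j).
     2 * (force D j \<bullet> v) - qform (stiffness D j (\<delta> \<cdot>\<^sub>v a)) v \<le> cbound D j)"

lemma qform_stiffness_smult:
  assumes "j < num_lc D" "v \<in> carrier_vec (ndof D j)" "a \<in> carrier_vec (num_el D)"
  shows "qform (stiffness D j (\<delta> \<cdot>\<^sub>v a)) v = qform (stiff0 D j) v +
    (\<Sum>e<num_el D. \<Sum>i=1..3. (\<delta> * a $ e) ^ i * qform (stiffc D j i e) v)"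
  using assms by (simp add: qform_stiffness)

lemma scaled_bound_mono:
  assumes j: "j < num_lc D" and a: "nonneg_vec (num_el D) a" and "0 \<le> \<delta>" "\<delta> \<le> \<delta>'"
    and "scaled_bound a j \<delta>"
  shows "scaled_bound a j \<delta>'"
  unfolding scaled_bound_def
proof
  fix v :: "real vec" assume v: "v \<in> carrier_vec (ndof D j)"
  have ac: "a \<in> carrier_vec (num_el D)" using a by (simp add: nonneg_vec_def)
  have "qform (stiffness D j (\<delta> \<cdot>\<^sub>v a)) v \<le> qform (stiffness D j (\<delta>' \<cdot>\<^sub>v a)) v"
    unfolding qform_stiffness_smult[OF j v ac] using assms(3,4) a qform_stiffc_nonneg[OF j v]
    by (intro add_left_mono sum_mono mult_right_mono power_mono) (auto simp: nonneg_vec_def)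
  then show "2 * (force D j \<bullet> v) - qform (stiffness D j (\<delta>' \<cdot>\<^sub>v a)) v \<le> cbound D j"
    using assms(5) v unfolding scaled_bound_def by fastforce
qed

text \<open>For each fixed v the left side is a polynomial in \<delta>, so the inequality passes to
  the limit from the right.\<close>

lemma scaled_bound_closed:
  assumes j: "j < num_lc D" and a: "a \<in> carrier_vec (num_el D)"
    and "\<And>\<delta>'. \<delta> < \<delta>' \<Longrightarrow> scaled_bound a j \<delta>'"
  shows "scaled_bound a j \<delta>"
  unfolding scaled_bound_def
proof
  fix v :: "real vec" assume v: "v \<in> carrier_vec (ndof D j)"
  let ?h = "\<lambda>\<delta>. 2 * (force D j \<bullet> v) - qform (stiffness D j (\<delta> \<cdot>\<^sub>v a)) v"
  have "(?h \<longlongrightarrow> ?h \<delta>) (at_right \<delta>)"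
    unfolding qform_stiffness_smult[OF j v a] by (intro tendsto_intros)
  moreover have "eventually (\<lambda>\<delta>'. ?h \<delta>' \<le> cbound D j) (at_right \<delta>)"
    using assms(3) v unfolding scaled_bound_def
    by (intro eventually_at_right_less[THEN eventually_mono]) auto
  ultimately show "?h \<delta> \<le> cbound D j"
    by (rule tendsto_upperbound) simp
qed

text \<open>At \<delta> = 0 only the constant term \<open>stiff0\<close> is left, whatever the
  direction; monotonicity along b does the rest.\<close>

lemma scaled_bound_zero_imp:
  assumes j: "j < num_lc D" and a: "a \<in> carrier_vec (num_el D)" and b: "nonneg_vec (num_el D) b"
    and "0 \<le> \<delta>" "scaled_bound a j 0"
  shows "scaled_bound b j \<delta>"
proof -
  have "scaled_bound b j 0"
    using assms unfolding scaled_bound_def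
    by (auto simp: qform_stiffness_smult nonneg_vec_def zero_power)
  then show ?thesis using scaled_bound_mono[OF j b] \<open>0 \<le> \<delta>\<close> by blast
qed

lemma U_feasibleI:
  assumes a: "nonneg_vec (num_el D) a" and \<delta>: "\<delta> > 0"
    and "\<And>j. j < num_lc D \<Longrightarrow> scaled_bound a j \<delta>"
  shows "U_feasible D a \<delta>"
  unfolding U_feasible_def
proof (intro conjI allI impI \<delta>)
  fix j assume j: "j < num_lc D"
  have "nonneg_vec (num_el D) (\<delta> \<cdot>\<^sub>v a)" using a \<delta> by (intro nonneg_vec_smult) auto
  then show "compliance D j (\<delta> \<cdot>\<^sub>v a) \<le> cbound D j"
    using compliance_le_iff[OF j] assms(3)[OF j] unfolding scaled_bound_def by blast
qed

text \<open>\<open>U_feasible\<close> bounds the pseudo-inverse formula alone; the image condition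
  needed for the variational form is supplied by \<open>compliance_domain\<close>, which persists
  under positive scaling.\<close>

lemma scaled_boundI:
  assumes dom: "compliance_domain D a" and j: "j < num_lc D" and \<delta>: "\<delta> > 0"
    and "compliance D j (\<delta> \<cdot>\<^sub>v a) \<le> cbound D j"
  shows "scaled_bound a j \<delta>"
proof -
  have "nonneg_vec (num_el D) (\<delta> \<cdot>\<^sub>v a)"
    using dom \<delta> by (auto simp: compliance_domain_def intro: nonneg_vec_smult)
  then show ?thesis
    using compliance_le_iff[OF j] force_in_image_smult[OF dom j \<delta>] assms(4)
    unfolding scaled_bound_def by blast
qed

lemma U_solution_exists:
  assumes dom: "compliance_domain D a"
    and inf: "\<And>j. j < num_lc D \<Longrightarrow> (INF \<delta>\<in>{0<..}. compliance D j (\<delta> \<cdot>\<^sub>v a)) < cbound D j"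
    and b: "nonneg_vec (num_el D) b" and sol: "U_solution D b \<delta>b"
  shows "\<exists>\<delta>. U_solution D a \<delta>"
proof -
  have a: "nonneg_vec (num_el D) a" "a \<in> carrier_vec (num_el D)"
    using dom by (auto simp: compliance_domain_def nonneg_vec_def)
  define F where "F = {\<delta>. \<delta> > 0 \<and> (\<forall>j<num_lc D. scaled_bound a j \<delta>)}"
  have F: "\<delta> \<in> F \<longleftrightarrow> U_feasible D a \<delta>" for \<delta>
    using U_feasibleI[OF a(1)] scaled_boundI[OF dom] unfolding F_def U_feasible_def by auto
  have "\<exists>\<delta>>0. scaled_bound a j \<delta>" if j: "j < num_lc D" for j
  proof -
    obtain \<delta> where "\<delta> > 0" "compliance D j (\<delta> \<cdot>\<^sub>v a) < cbound D j"
      using cInf_lessD[OF _ inf[OF j]] by auto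
    then show ?thesis using scaled_boundI[OF dom j] by force
  qed
  then obtain d where d: "\<And>j. j < num_lc D \<Longrightarrow> d j > 0 \<and> scaled_bound a j (d j)"
    by metis
  have "num_lc D > 0" using valid by (simp add: valid_data_def)
  \<comment> \<open>The sum of the positive \<open>d j\<close> dominates each of them, so by
    monotonicity it satisfies the bounds of all load cases at once.\<close>
  then have "(\<Sum>j<num_lc D. d j) > 0" using d by (intro sum_pos) auto
  moreover have "scaled_bound a j (\<Sum>j<num_lc D. d j)" if "j < num_lc D" for j
  proof (rule scaled_bound_mono[OF that a(1)])
    show "0 \<le> d j" and "scaled_bound a j (d j)" using d[OF that] by auto
    show "d j \<le> (\<Sum>j<num_lc D. d j)"
      by (rule member_le_sum) (use d that in \<open>auto intro: less_imp_le\<close>)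
  qed
  ultimately have ne: "F \<noteq> {}" by (auto simp: F_def)
  have bdd: "bdd_below F" by (rule bdd_belowI[of _ 0]) (simp add: F_def)
  define m where "m = Inf F"
  have m0: "m \<ge> 0" unfolding m_def using ne by (intro cInf_greatest) (auto simp: F_def)
  \<comment> \<open>Every number above the infimum lies above some member of F, so monotonicity and
    closedness give the bound at m itself, even if m is zero.\<close>
  have m: "scaled_bound a j m" if j: "j < num_lc D" for j
  proof (rule scaled_bound_closed[OF j a(2)])
    fix \<delta>' assume "m < \<delta>'"
    then obtain \<delta> where "\<delta> \<in> F" "\<delta> < \<delta>'" using cInf_lessD[OF ne] by (auto simp: m_def)
    then show "scaled_bound a j \<delta>'"
      using scaled_bound_mono[OF j a(1), of \<delta> \<delta>'] j by (auto simp: F_def)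
  qed
  \<comment> \<open>A bound at zero would carry over to b and make \<open>\<delta>b / 2\<close>
    feasible there, against the minimality of \<open>\<delta>b\<close>.\<close>
  have "m \<noteq> 0"
  proof
    assume "m = 0"
    have "\<delta>b > 0" using sol by (simp add: U_solution_def U_feasible_def)
    then have "U_feasible D b (\<delta>b / 2)"
      using m \<open>m = 0\<close> by (intro U_feasibleI[OF b] scaled_bound_zero_imp[OF _ a(2) b]) auto
    then show False using sol \<open>\<delta>b > 0\<close> by (force simp: U_solution_def)
  qed
  then have "m \<in> F" using m m0 by (auto simp: F_def)
  then have "U_solution D a m"
    unfolding U_solution_def F[symmetric] using bdd by (auto simp: m_def intro: cInf_lower)
  then show ?thesis ..
qed

lemma U_feasible_imp_P_feasible:
  assumes dom: "compliance_domain D a" and U: "U_feasible D a \<delta>"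
  shows "\<exists>u. P_feasible D (\<delta> \<cdot>\<^sub>v a) u"
proof -
  have \<delta>: "\<delta> > 0" using U by (simp add: U_feasible_def)
  have na: "nonneg_vec (num_el D) (\<delta> \<cdot>\<^sub>v a)"
    using dom \<delta> by (auto simp: compliance_domain_def intro: nonneg_vec_smult)
  have "\<exists>u. u \<in> carrier_vec (ndof D j) \<and> stiffness D j (\<delta> \<cdot>\<^sub>v a) *\<^sub>v u = force D j \<and>
      0 \<le> cbound D j - force D j \<bullet> u" if j: "j < num_lc D" for j
  proof -
    let ?K = "stiffness D j (\<delta> \<cdot>\<^sub>v a)"
    obtain u where u: "u \<in> carrier_vec (ndof D j)" "force D j = ?K *\<^sub>v u"
      using force_in_image_smult[OF dom j \<delta>] stiffness_carrier[of j "\<delta> \<cdot>\<^sub>v a"]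
      by (auto simp: mat_image_def)
    have "transpose_mat ?K = ?K" using psd_stiffness[OF j na] by (simp add: psd_def)
    then have "force D j \<bullet> u = compliance D j (\<delta> \<cdot>\<^sub>v a)"
      using pinv_scalar_prod[OF stiffness_carrier _ u] by (simp add: compliance_def)
    then show ?thesis using u U j by (auto simp: U_feasible_def)
  qed
  then obtain u where "\<And>j. j < num_lc D \<Longrightarrow> u j \<in> carrier_vec (ndof D j) \<and>
      stiffness D j (\<delta> \<cdot>\<^sub>v a) *\<^sub>v u j = force D j \<and> 0 \<le> cbound D j - force D j \<bullet> u j"
    by metis
  then show ?thesis using na unfolding P_feasible_def by blast
qed

lemma P_value_le_weight:
  assumes "P_feasible D a u"
  shows "P_value D \<le> weight D a"
  unfolding P_value_def
proof (rule cInf_lower)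
  show "bdd_below {weight D a |a u. P_feasible D a u}"
  proof (rule bdd_belowI[of _ 0])
    fix x assume "x \<in> {weight D a |a u. P_feasible D a u}"
    then show "0 \<le> x"
      by (auto simp: weight_def P_feasible_def nonneg_vec_def
          intro!: sum_nonneg mult_nonneg_nonneg[OF less_imp_le[OF element_pos]])
  qed
qed (use assms in blast)

end

section \<open>The relaxation of the scaled problem\<close>

lemma single_nat_eq_iff:
  "Poly_Mapping.single e k = Poly_Mapping.single e' (k' :: nat) \<longleftrightarrow> k = k' \<and> (k = 0 \<or> e = e')"
  by (metis lookup_single_eq lookup_single_not_eq single_zero)

text \<open>The coefficient of x_e^3 in the i-th power of \<alpha> (x_e' + 1): up to degree three,
  only the cube of the same variable contributes.\<close>

lemma area_moment_indicator:
  assumes "i \<in> {1..3}"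
  shows "area_moment \<alpha> e' (\<lambda>m. if m = Poly_Mapping.single e 3 then 1 else 0) i =
    (if i = 3 \<and> e' = e then \<alpha> ^ 3 else 0)"
proof -
  have "(\<Sum>k\<le>i. real (i choose k) *
      (if Poly_Mapping.single e' k = Poly_Mapping.single e 3 then 1 else 0)) =
    (\<Sum>k\<le>i. if k = 3 then (if e' = e then real (i choose 3) else 0) else 0)"
    by (intro sum.cong) (auto simp: single_nat_eq_iff)
  also have "\<dots> = (if i = 3 \<and> e' = e then 1 else 0)"
    using assms by auto
  finally show ?thesis by (simp add: area_moment_def)
qed

lemma area_moment_eval:
  fixes y :: "monomial \<Rightarrow> real"
  assumes "y 0 = 1"
  shows "area_moment \<alpha> e y 1 = \<alpha> * (1 + y (Poly_Mapping.single e 1))"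
    and "area_moment \<alpha> e y 2 =
      \<alpha>\<^sup>2 * (1 + 2 * y (Poly_Mapping.single e 1) + y (Poly_Mapping.single e 2))"
    and "area_moment \<alpha> e y 3 = \<alpha> ^ 3 * (1 + 3 * y (Poly_Mapping.single e 1) +
      3 * y (Poly_Mapping.single e 2) + y (Poly_Mapping.single e 3))"
  using assms by (simp_all add: area_moment_def numeral_eq_Suc)

lemma bordered_entries:
  assumes "K \<in> carrier_mat (dim_vec f) (dim_vec f)"
  shows "dim_row (bordered c f K) = Suc (dim_vec f)" "dim_col (bordered c f K) = Suc (dim_vec f)"
    "bordered c f K $$ (0, 0) = c"
    "q < dim_vec f \<Longrightarrow> bordered c f K $$ (0, Suc q) = - (f $ q)"
    "p < dim_vec f \<Longrightarrow> bordered c f K $$ (Suc p, 0) = - (f $ p)"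
    "p < dim_vec f \<Longrightarrow> q < dim_vec f \<Longrightarrow> bordered c f K $$ (Suc p, Suc q) = K $$ (p, q)"
  using assms by (auto simp: bordered_def)

section \<open>Inequalities between the moments of one variable\<close>

lemma moment_form_univariate:
  assumes psd: "psd (moment_mat n (2 * r) y)" and "e < n" "N \<le> Suc r"
  shows "0 \<le> (\<Sum>a<N. \<Sum>b<N. y (Poly_Mapping.single e (a + b)) * (x a * x b))"
  using moment_form_nonneg[OF psd, of N "Poly_Mapping.single e" x] assms(2,3)
  by (simp add: single_in_monomials single_add)

text \<open>Nonnegativity of the variance: the moment form is evaluated at x_e minus its first
  moment.\<close>

lemma square_first_moment_le:
  assumes "psd (moment_mat n (2 * r) y)" "e < n" "1 \<le> r" "y 0 = 1"
  shows "(y (Poly_Mapping.single e 1))\<^sup>2 \<le> y (Poly_Mapping.single e 2)"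
  using moment_form_univariate[OF assms(1,2), of 2 "\<lambda>a. if a = 0 then - y (Poly_Mapping.single e 1) else 1"]
    assms(3,4)
  by (simp add: numeral_eq_Suc power2_eq_square)

text \<open>If \<open>1 + x\<close> has vanishing second moment, it lies in the kernel of the moment form, so it is
  orthogonal to \<open>x\<^sup>2\<close>.\<close>

lemma third_moment_at_lower_bound:
  assumes psd: "psd (moment_mat n (2 * r) y)" and e: "e < n" and r: "2 \<le> r" and y: "y 0 = 1"
    and y1: "y (Poly_Mapping.single e 1) = - 1" and y2: "y (Poly_Mapping.single e 2) = 1"
  shows "y (Poly_Mapping.single e 3) = - 1"
proof -
  have "2 * (t * - (y (Poly_Mapping.single e 2) + y (Poly_Mapping.single e 3)))
      \<le> y (Poly_Mapping.single e 4)" for t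
  proof -
    \<comment> \<open>The moment form at t (1 + x) + x^2. Its t^2 coefficient is
      \<open>1 + 2 y_1 + y_2 = 0\<close>, so what remains is affine in t and bounded below.\<close>
    have "0 \<le> (\<Sum>a<3. \<Sum>b<3. y (Poly_Mapping.single e (a + b)) *
        ((if a < 2 then t else 1) * (if b < 2 then t else 1)))"
      using r by (intro moment_form_univariate[OF psd e]) simp
    then show ?thesis using y y1 y2 by (simp add: numeral_eq_Suc algebra_simps)
  qed
  from zero_if_multiples_bounded[OF this] show ?thesis using y2 by simp
qed

context
  fixes D :: weight_data and w :: real
  assumes valid: "valid_data D"
begin

section \<open>Blocks and degree of the constraint matrix\<close>

lemma S_stiffness_carrier: "S_stiffness D w j \<in> carrier_mat (ndof D j) (ndof D j)"
  by (simp add: S_stiffness_def)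

lemma S_block_entries:
  assumes "j < num_lc D"
  shows "S_stiffness D w j \<in> carrier_mat (dim_vec (map_vec pconst (force D j)))
      (dim_vec (map_vec pconst (force D j)))"
    "dim_vec (map_vec pconst (force D j)) = ndof D j"
  using data_props(1)[OF valid assms] S_stiffness_carrier by auto

definition S_blocks :: "mpoly mat list" where
  "S_blocks = map (\<lambda>j. bordered (pconst (cbound D j)) (map_vec pconst (force D j)) (S_stiffness D w j))
        [0..<num_lc D] @
      map (\<lambda>e. mat 1 1 (\<lambda>_. 1 - pvar e ^ 2)) [0..<num_el D]"

lemma S_constraint_blocks: "S_constraint D w = diag_block_mat S_blocks"
  by (simp add: S_constraint_def S_blocks_def)

lemma S_blocks_square: "A \<in> set S_blocks \<Longrightarrow> square_mat A"
  using bordered_entries(1,2)[OF S_block_entries(1)] by (auto simp: S_blocks_def)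

lemma S_constraint_square: "dim_col (S_constraint D w) = dim_row (S_constraint D w)"
  using diag_block_mat_square[of S_blocks] S_blocks_square by (auto simp: S_constraint_blocks)

lemma S_constraint_load_block:
  assumes j: "j < num_lc D"
  shows "\<exists>off. off + Suc (ndof D j) \<le> dim_row (S_constraint D w) \<and>
    (\<forall>p<Suc (ndof D j). \<forall>q<Suc (ndof D j). S_constraint D w $$ (off + p, off + q) =
       bordered (pconst (cbound D j)) (map_vec pconst (force D j)) (S_stiffness D w j) $$ (p, q))"
proof -
  have "S_blocks ! j = bordered (pconst (cbound D j)) (map_vec pconst (force D j)) (S_stiffness D w j)"
    "j < length S_blocks"
    using j by (auto simp: S_blocks_def nth_append)
  then show ?thesis
    using diag_block_mat_entries[of j S_blocks, OF _ S_blocks_square]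
      bordered_entries(1)[OF S_block_entries(1)[OF j]] S_block_entries(2)[OF j]
    by (simp add: S_constraint_blocks)
qed

lemma S_constraint_box_block:
  assumes e: "e < num_el D"
  shows "\<exists>off<dim_row (S_constraint D w). S_constraint D w $$ (off, off) = 1 - pvar e ^ 2"
proof -
  have "S_blocks ! (num_lc D + e) = mat 1 1 (\<lambda>_. 1 - pvar e ^ 2)" "num_lc D + e < length S_blocks"
    using e by (auto simp: S_blocks_def nth_append)
  then show ?thesis
    using diag_block_mat_entries[of "num_lc D + e" S_blocks, OF _ S_blocks_square]
    by (auto simp: S_constraint_blocks Suc_le_eq)
qed

lemma riesz_box: "riesz y (1 - pvar e ^ 2) = y 0 - y (Poly_Mapping.single e 2)"
proof -
  have "1 - pvar e ^ 2 = pconst 1 + - Poly_Mapping.single (Poly_Mapping.single e 2) 1"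
    by (simp add: pvar_power pconst_1)
  then show ?thesis
    by (simp only: riesz_add riesz_uminus riesz_single) (simp add: pconst_def riesz_single del: single_one)
qed

text \<open>The box constraint of the first element contains a square. Every admissible relaxation
  order is therefore at least one.\<close>

lemma pmat_degree_ge_2: "2 \<le> pmat_degree (S_constraint D w)"
proof -
  have e: "0 < num_el D" using valid by (simp add: valid_data_def)
  obtain off where off: "off < dim_row (S_constraint D w)"
    "S_constraint D w $$ (off, off) = 1 - pvar 0 ^ 2"
    using S_constraint_box_block[OF e] by blast
  have "Poly_Mapping.lookup (1 - pvar 0 ^ 2) (Poly_Mapping.single 0 2) \<noteq> 0"
    unfolding lookup_conv_riesz riesz_box
    using single_nat_eq_iff[of 0 0 0 2] by simp
  then show ?thesis
    using mdeg_le_pmat_degree[of off "S_constraint D w" off "Poly_Mapping.single 0 2"] off S_constraint_square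
    by (simp add: mdeg_single del: single_numeral)
qed

text \<open>The coefficient of x_e^3 in this entry is \<open>stiffc D j 3 e\<close> times \<alpha>^3
  and cannot cancel, because the other areas and the lower powers do not produce that
  monomial.\<close>

lemma pmat_degree_ge_3:
  assumes j: "j < num_lc D" and e: "e < num_el D" and pq: "p < ndof D j" "q < ndof D j"
    and nz: "stiffc D j 3 e $$ (p, q) \<noteq> 0" and w: "w \<noteq> 0"
  shows "3 \<le> pmat_degree (S_constraint D w)"
proof -
  define \<alpha> where "\<alpha> = w / (2 * (dens D e * len D e))"
  have \<alpha>: "\<alpha> \<noteq> 0" using w element_pos[OF valid e] by (auto simp: \<alpha>_def)
  obtain off where off: "off + Suc (ndof D j) \<le> dim_row (S_constraint D w)"
    "\<forall>p<Suc (ndof D j). \<forall>q<Suc (ndof D j). S_constraint D w $$ (off + p, off + q) =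
       bordered (pconst (cbound D j)) (map_vec pconst (force D j)) (S_stiffness D w j) $$ (p, q)"
    using S_constraint_load_block[OF j] by blast
  let ?P = "S_constraint D w $$ (off + Suc p, off + Suc q)"
  let ?y = "\<lambda>m :: monomial. if m = Poly_Mapping.single e 3 then 1 else 0 :: real"
  have P: "?P = S_stiffness D w j $$ (p, q)"
    using off(2)[rule_format, of "Suc p" "Suc q"] pq
      bordered_entries(6)[OF S_block_entries(1)[OF j]] S_block_entries(2)[OF j] by simp
  have y0: "?y 0 = 0" using single_nat_eq_iff[of e 0 e 3] by simp
  have "Poly_Mapping.lookup ?P (Poly_Mapping.single e 3) =
    (\<Sum>e'<num_el D. \<Sum>i\<in>{1..3::nat}.
       if i = 3 then if e' = e then stiffc D j 3 e $$ (p, q) * \<alpha> ^ 3 else 0 else 0)"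
    unfolding P lookup_conv_riesz riesz_S_stiffness[OF pq] y0 mult_zero_right add_0_left
    by (intro sum.cong refl) (simp add: area_moment_indicator \<alpha>_def)
  also have "\<dots> = stiffc D j 3 e $$ (p, q) * \<alpha> ^ 3" using e by simp
  finally have "Poly_Mapping.lookup ?P (Poly_Mapping.single e 3) \<noteq> 0" using nz \<alpha> by simp
  then show ?thesis
    using mdeg_le_pmat_degree[of "off + Suc p" "S_constraint D w" "off + Suc q" "Poly_Mapping.single e 3"]
      off(1) pq S_constraint_square
    by (simp add: mdeg_single)
qed

context
  fixes r :: nat and y :: "monomial \<Rightarrow> real"
  assumes feas: "relax_feasible (num_el D) (S_constraint D w) r y"
    and order: "pmat_degree (S_constraint D w) \<le> 2 * r"
begin

section \<open>Consequences of feasibility for the relaxation\<close>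

lemma relax_load_bound:
  assumes j: "j < num_lc D" and v: "v \<in> carrier_vec (ndof D j)"
  shows "2 * (force D j \<bullet> v) - (qform (stiff0 D j) v + (\<Sum>e<num_el D. \<Sum>i=1..3.
    area_moment (w / (2 * (dens D e * len D e))) e y i * qform (stiffc D j i e) v)) \<le> cbound D j"
proof -
  let ?n = "ndof D j"
  let ?B = "bordered (pconst (cbound D j)) (map_vec pconst (force D j)) (S_stiffness D w j)"
  let ?K = "mat ?n ?n (\<lambda>pq. stiff0 D j $$ pq + (\<Sum>e<num_el D. \<Sum>i\<in>{1..3}. stiffc D j i e $$ pq *
       area_moment (w / (2 * (dens D e * len D e))) e y i))"
  \<comment> \<open>The test vector (1, v): on the linearized bordered matrix it gives the bound
    minus \<open>2 f . v\<close> plus the linearized quadratic form.\<close>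
  let ?x = "\<lambda>a. case a of 0 \<Rightarrow> 1 | Suc p \<Rightarrow> v $ p"
  have y0: "y 0 = 1" and psd: "psd (localizing_mat (num_el D)
      (2 * r - pmat_degree (S_constraint D w)) (S_constraint D w) y)"
    using feas by (auto simp: relax_feasible_def)
  obtain off where off: "off + Suc ?n \<le> dim_row (S_constraint D w)"
    "\<forall>p<Suc ?n. \<forall>q<Suc ?n. S_constraint D w $$ (off + p, off + q) = ?B $$ (p, q)"
    using S_constraint_load_block[OF j] by blast
  have f: "force D j \<in> carrier_vec ?n" by (rule data_props(1)[OF valid j])
  have rc: "riesz y (pconst c) = c" for c by (simp add: pconst_def riesz_single y0)
  note ent = bordered_entries[OF S_block_entries(1)[OF j], unfolded S_block_entries(2)[OF j]]
  have "0 \<le> (\<Sum>a<Suc ?n. \<Sum>b<Suc ?n. riesz y (S_constraint D w $$ (off + a, off + b)) * (?x a * ?x b))"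
    using off(1) by (intro localizing_form_nonneg[OF psd S_constraint_square]) simp
  also have "\<dots> = (\<Sum>a<Suc ?n. \<Sum>b<Suc ?n. riesz y (?B $$ (a, b)) * (?x a * ?x b))"
    using off(2) by (intro sum.cong refl) simp
  also have "\<dots> = cbound D j - (\<Sum>q<?n. force D j $ q * v $ q) - (\<Sum>p<?n. force D j $ p * v $ p) +
      (\<Sum>p<?n. \<Sum>q<?n. riesz y (S_stiffness D w j $$ (p, q)) * (v $ p * v $ q))"
    unfolding sum.lessThan_Suc_shift
    using f by (simp add: ent rc riesz_uminus sum.distrib sum_negf sum_subtractf)
  also have "(\<Sum>p<?n. \<Sum>q<?n. riesz y (S_stiffness D w j $$ (p, q)) * (v $ p * v $ q)) = qform ?K v"
    by (subst qform_sum[OF _ v]) (simp_all add: riesz_S_stiffness y0)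
  also have "(\<Sum>q<?n. force D j $ q * v $ q) = force D j \<bullet> v"
    using v by (simp add: scalar_prod_def atLeast0LessThan)
  also have "qform ?K v = qform (stiff0 D j) v + (\<Sum>e<num_el D. \<Sum>i=1..3.
      area_moment (w / (2 * (dens D e * len D e))) e y i * qform (stiffc D j i e) v)"
    by (rule qform_combination[OF v data_props(2)[OF valid j] data_props(4)[OF valid j]])
  finally show ?thesis by simp
qed

lemma relax_moment_facts: "y 0 = 1" "psd (moment_mat (num_el D) (2 * r) y)" "1 \<le> r"
  using feas order pmat_degree_ge_2 by (auto simp: relax_feasible_def)

lemma relax_second_moment_le:
  assumes e: "e < num_el D"
  shows "y (Poly_Mapping.single e 2) \<le> 1"
proof -
  have psd: "psd (localizing_mat (num_el D)
      (2 * r - pmat_degree (S_constraint D w)) (S_constraint D w) y)"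
    using feas by (auto simp: relax_feasible_def)
  obtain off where "off < dim_row (S_constraint D w)"
    "S_constraint D w $$ (off, off) = 1 - pvar e ^ 2"
    using S_constraint_box_block[OF e] by blast
  then show ?thesis
    using localizing_form_nonneg[OF psd S_constraint_square, of "Suc 0" "\<lambda>_. off" "\<lambda>_. 1"]
    by (simp add: riesz_box relax_moment_facts(1))
qed

text \<open>Follows from \<open>y_1^2 \<le> y_2 \<le> 1\<close>, and makes the recovered areas
  nonnegative.\<close>

lemma relax_first_moment_ge:
  assumes e: "e < num_el D"
  shows "- 1 \<le> y (Poly_Mapping.single e 1)"
proof -
  have "(y (Poly_Mapping.single e 1))\<^sup>2 \<le> 1"
    using square_first_moment_le[OF relax_moment_facts(2) e relax_moment_facts(3,1)]
      relax_second_moment_le[OF e] by linarith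
  then show ?thesis by (simp add: abs_square_le_1 abs_le_iff)
qed

text \<open>The product is claimed, and not the moment alone, because at order one the third moment
  is unconstrained; there the degree bound makes the cubic stiffness coefficient zero
  instead.\<close>

lemma area_moment_vanishes:
  assumes j: "j < num_lc D" and e: "e < num_el D" and w: "w \<noteq> 0"
    and y1: "y (Poly_Mapping.single e 1) = - 1"
    and i: "i \<in> {1..3}" and v: "v \<in> carrier_vec (ndof D j)"
  shows "area_moment \<alpha> e y i * qform (stiffc D j i e) v = 0"
proof -
  note m = relax_moment_facts
  \<comment> \<open>The second moment is squeezed between the square of the first and the box bound,
    both equal to 1.\<close>
  have y2: "y (Poly_Mapping.single e 2) = 1"
    using square_first_moment_le[OF m(2) e m(3,1)] relax_second_moment_le[OF e] y1 by simp
  consider "i = 1" | "i = 2" | "i = 3" "2 \<le> r" | "i = 3" "r = 1"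
    using i m(3) by force
  then show ?thesis
  proof cases
    case 3
    then show ?thesis
      using area_moment_eval(3)[of y, OF m(1)] third_moment_at_lower_bound[OF m(2) e _ m(1) y1 y2] y1 y2
      by simp
  next
    case 4
    then have "stiffc D j 3 e $$ (p, q) = 0" if "p < ndof D j" "q < ndof D j" for p q
      using pmat_degree_ge_3[OF j e that _ w] order by fastforce
    then have "qform (stiffc D j i e) v = 0"
      using 4 by (subst qform_sum[OF data_props(4)[OF valid j e i] v]) simp
    then show ?thesis by simp
  qed (use area_moment_eval(1,2)[of y, OF m(1)] y1 y2 in auto)
qed

lemma recovered_compliance_domain:
  assumes w: "w > 0"
  shows "compliance_domain D (recovered D w y)"
proof -
  have a: "recovered D w y $ e =
      (y (Poly_Mapping.single e 1) + 1) / 2 * (w / (dens D e * len D e))" if "e < num_el D" for e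
    using that by (simp add: recovered_def mvar_def)
  have nn: "nonneg_vec (num_el D) (recovered D w y)"
    unfolding nonneg_vec_def
  proof (intro conjI allI impI)
    fix e assume e: "e < num_el D"
    show "0 \<le> recovered D w y $ e"
      unfolding a[OF e] using relax_first_moment_ge[OF e] element_pos[OF valid e] w by simp
  qed (simp add: recovered_def)
  moreover have "force D j \<in> mat_image (stiffness D j (recovered D w y))" if j: "j < num_lc D" for j
  \<comment> \<open>The coefficients c are the area moments from the relaxation. A zero recovered
    area means first moment -1 because w is positive, and then the terms of that element
    vanish.\<close>
  proof (rule force_in_image_if_supported[OF valid j nn relax_load_bound[OF j]])
    fix e i :: nat and v :: "real vec" assume e: "e < num_el D" and i: "i \<in> {1..3}" and "recovered D w y $ e = 0"
      and v: "v \<in> carrier_vec (ndof D j)"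
    then have "y (Poly_Mapping.single e 1) = - 1"
      using a[OF e] element_pos[OF valid e] w by auto
    then show "area_moment (w / (2 * (dens D e * len D e))) e y i * qform (stiffc D j i e) v = 0"
      using w by (intro area_moment_vanishes[OF j e _ _ i v]) auto
  qed
  ultimately show ?thesis by (simp add: compliance_domain_def)
qed

end

end

theorem theorem2:
  fixes D :: weight_data
    and a_hat a_tilde :: "real vec"
    and \<delta>_hat w :: real
    and r :: nat
    and y :: "monomial \<Rightarrow> real"
  assumes "valid_data D"
    and "pos_vec (num_el D) a_hat"
    and "U_solution D a_hat \<delta>_hat"
    and "w = \<delta>_hat * (\<Sum>e<num_el D. dens D e * len D e * a_hat $ e)"
    and "pmat_degree (S_constraint D w) \<le> 2 * r"
    and "relax_optimal (num_el D) (S_objective D w) (S_constraint D w) r y"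
    and "a_tilde = recovered D w y"
    and "\<And>j. j < num_lc D \<Longrightarrow> (INF \<delta>\<in>{0<..}. compliance D j (\<delta> \<cdot>\<^sub>v a_tilde)) < cbound D j"
    and "P_solvable D"
  shows "compliance_domain D a_tilde \<and>
    (\<exists>\<delta>. U_solution D a_tilde \<delta>) \<and>
    (\<forall>\<delta>. U_solution D a_tilde \<delta> \<longrightarrow>
       (\<exists>u. P_feasible D (\<delta> \<cdot>\<^sub>v a_tilde) u) \<and> P_value D \<le> weight D (\<delta> \<cdot>\<^sub>v a_tilde))"
proof -
  have "num_el D > 0" using assms(1) by (simp add: valid_data_def)
  then have "(\<Sum>e<num_el D. dens D e * len D e * a_hat $ e) > 0"
    using assms(2) by (intro sum_pos mult_pos_pos[OF element_pos[OF assms(1)]]) (auto simp: pos_vec_def)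
  then have w: "w > 0" using assms(3,4) by (simp add: U_solution_def U_feasible_def)
  have dom: "compliance_domain D a_tilde"
    unfolding assms(7)
    using assms(6) by (intro recovered_compliance_domain[OF assms(1) _ assms(5) w])
      (simp add: relax_optimal_def)
  \<comment> \<open>The reference design \<open>a_hat\<close>, whose univariate problem has the
    solution \<open>\<delta>_hat\<close>, serves as the comparison that excludes the infimum
    zero.\<close>
  moreover have "\<exists>\<delta>. U_solution D a_tilde \<delta>"
    using assms(2) by (intro U_solution_exists[OF assms(1) dom assms(8) _ assms(3)])
      (auto simp: pos_vec_def nonneg_vec_def less_imp_le)
  moreover have "(\<exists>u. P_feasible D (\<delta> \<cdot>\<^sub>v a_tilde) u) \<and> P_value D \<le> weight D (\<delta> \<cdot>\<^sub>v a_tilde)"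
    if U: "U_solution D a_tilde \<delta>" for \<delta>
  proof -
    obtain u where "P_feasible D (\<delta> \<cdot>\<^sub>v a_tilde) u"
      using U_feasible_imp_P_feasible[OF assms(1) dom] U unfolding U_solution_def by blast
    then show ?thesis using P_value_le_weight[OF assms(1)] by blast
  qed
  ultimately show ?thesis by blast
qed

end
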